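(* Let $\mathbb{G}=(\mathbb{R}^n,\cdot)$ be a Carnot group of step $s\ge 2$ with basis $X_1,\dots,X_m$ of its horizontal layer $V_1$. Assume that for some $V=\xi\cdot X\in V_1$, with $\xi\in\mathbb{R}^m$, there is $p\in\mathbb{N}$ such that the $p$-th multiexponential map $\Gamma^{(p)}$ is locally open at $(\xi,\xi,\dots,\xi)\in(\mathbb{R}^m)^p$, i.e. for all $\varepsilon>0$ there is $\sigma_\varepsilon>0$ such that $$\Gamma^{(p)}\big(B_{\mathrm{Euc}}((\xi,\dots,\xi),\varepsilon)\big)\supset B_{\mathrm{Euc}}\big(\Gamma^{(p)}(\xi,\dots,\xi),\sigma_\varepsilon\big).$$ Let also $A\subset\mathbb{G}$ be a horizontally convex set such that for some $\overline{x}\in\overline{A}$ we have $\overline{x}\cdot\exp(V)\in\operatorname{int}(A)$. Then there is $\varepsilon>0$ such that for all $x\in\overline{A}$ with $d(x,\overline{x})<\varepsilon$ we have $$\bigcup_{0<s<1}B\big(x\cdot\exp(sV),\varepsilon s\big)\subset\operatorname{int}(A).$$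
   Context: Carnot group of step $s\ge2$: a Lie group $\mathbb{G}=(\mathbb{R}^n,\cdot)$ with identity $0$, where $\mathbb{R}^n=\mathbb{R}^{m_1}\times\cdots\times\mathbb{R}^{m_s}\ni x=(x^{(1)},\dots,x^{(s)})$, such that for every $\lambda>0$ the dilation $\delta_\lambda(x)=(\lambda x^{(1)},\lambda^2x^{(2)},\dots,\lambda^s x^{(s)})$ is a group automorphism. Put $m=m_1$ and let $X_1,\dots,X_m$ be the left-invariant vector fields with $X_j(0)=\partial_{x_j}$, $j=1,\dots,m$; one assumes they satisfy the Hörmander condition. The Lie algebra is stratified, $\mathfrak{g}=V_1\oplus\cdots\oplus V_s$, with $V_1=\operatorname{span}\{X_1,\dots,X_m\}$ and $[V_1,V_j]=V_{j+1}$ for $j\le s-1$. For $u=(u^1,\dots,u^m)\in\mathbb{R}^m$, $u\cdot X:=\sum_{k=1}^m u^kX_k\in V_1$. The map $\exp:\mathfrak{g}\to\mathbb{G}$ is the Lie group exponential: $\exp(Z)$ is the value at time $1$ of the integral curve of $Z$ starting at $0$. Multiexponential maps: for $p\in\mathbb{N}$ (a positive integer), $\Gamma^{(p)}:(\mathbb{R}^m)^p\to\mathbb{G}=\mathbb{R}^n$, $\Gamma^{(p)}(u_1,\dots,u_p):=\exp(u_1\cdot X)\cdot\exp(u_2\cdot X)\cdots\exp(u_p\cdot X)$. $B_{\mathrm{Euc}}(c,r)$ denotes the Euclidean ball with center $c$ and radius $r$. The subRiemannian distance $d(x,y)$ is the infimum of $\int_a^b|u(\tau)|\,d\tau$ over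 Lipschitz curves $\gamma:[a,b]\to\mathbb{R}^n$ connecting $x$ and $y$ with $\dot\gamma=\sum_{j=1}^m u_j(\tau)X_j(\gamma)$ a.e., where $u\in L^1((a,b),\mathbb{R}^m)$. $B(x,r)$ is the ball with center $x$ and radius $r$ with respect to $d$. $\operatorname{int}(A)$ and $\overline{A}$ are the interior and the closure of $A$ in the Euclidean topology (which coincides with the topology of $d$). A horizontal line is a set $\{\gamma(s):=x\cdot\exp(sW):s\in\mathbb{R}\}$ with $x\in\mathbb{G}$, $W\in V_1$. A set $A\subset\mathbb{G}$ is horizontally convex if, whenever two points $\gamma(a),\gamma(b)$ of a horizontal line belong to $A$, the whole horizontal segment $\gamma([a,b])$ is contained in $A$. *)

theory Defs
  imports "HOL-Analysis.Analysis" "HOL-Algebra.Group"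
begin

subsection \<open>Smooth maps and vector fields on Euclidean space\<close>

primrec C_k :: "nat \<Rightarrow> ('a::euclidean_space \<Rightarrow> 'b::real_normed_vector) \<Rightarrow> bool" where
  "C_k 0 f \<longleftrightarrow> continuous_on UNIV f"
| "C_k (Suc k) f \<longleftrightarrow>
     (\<exists>f'. (\<forall>x. (f has_derivative f' x) (at x)) \<and> (\<forall>v. C_k k (\<lambda>x. f' x v)))"

definition smooth :: "('a::euclidean_space \<Rightarrow> 'b::real_normed_vector) \<Rightarrow> bool" where
  "smooth f \<longleftrightarrow> (\<forall>k. C_k k f)"

text \<open>A vector field \<open>\<Sum>i. Z\<^sub>i \<partial>\<^sub>i\<close> is represented by its coefficient map \<open>Z\<close>.\<close>

definition lie_bracket ::
    "('a::euclidean_space \<Rightarrow> 'a) \<Rightarrow> ('a \<Rightarrow> 'a) \<Rightarrow> 'a \<Rightarrow> 'a" where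
  "lie_bracket Y Z = (\<lambda>x. frechet_derivative Z (at x) (Y x) - frechet_derivative Y (at x) (Z x))"

inductive_set lie_generated :: "('a::euclidean_space \<Rightarrow> 'a) set \<Rightarrow> ('a \<Rightarrow> 'a) set"
  for S where
  base: "Z \<in> S \<Longrightarrow> Z \<in> lie_generated S"
| add: "\<lbrakk>Y \<in> lie_generated S; Z \<in> lie_generated S\<rbrakk> \<Longrightarrow> (\<lambda>x. Y x + Z x) \<in> lie_generated S"
| scale: "Z \<in> lie_generated S \<Longrightarrow> (\<lambda>x. c *\<^sub>R Z x) \<in> lie_generated S"
| bracket: "\<lbrakk>Y \<in> lie_generated S; Z \<in> lie_generated S\<rbrakk> \<Longrightarrow> lie_bracket Y Z \<in> lie_generated S"

definition hormander :: "('a::euclidean_space \<Rightarrow> 'a) set \<Rightarrow> bool" where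
  "hormander S \<longleftrightarrow> (\<forall>x. span {Z x |Z. Z \<in> lie_generated S} = UNIV)"


subsection \<open>Carnot groups\<close>

definition lie_group :: "('a::euclidean_space) monoid \<Rightarrow> bool" where
  "lie_group G \<longleftrightarrow> group G \<and> carrier G = UNIV \<and>
     smooth (\<lambda>(x, y). x \<otimes>\<^bsub>G\<^esub> y) \<and> smooth (\<lambda>x. inv\<^bsub>G\<^esub> x)"

definition left_invariant :: "('a::euclidean_space) monoid \<Rightarrow> ('a \<Rightarrow> 'a) \<Rightarrow> bool" where
  "left_invariant G Z \<longleftrightarrow>
     (\<forall>x y. Z (x \<otimes>\<^bsub>G\<^esub> y) = frechet_derivative (\<lambda>z. x \<otimes>\<^bsub>G\<^esub> z) (at y) (Z y))"

definition dilation :: "('n \<Rightarrow> nat) \<Rightarrow> real \<Rightarrow> real^'n \<Rightarrow> real^'n" where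
  "dilation wt r x = (\<chi> i. r ^ wt i * x $ i)"

text \<open>
  The splitting \<open>\<real>\<^sup>n = \<real>\<^bsup>m\<^sub>1\<^esup> \<times> \<dots> \<times> \<real>\<^bsup>m\<^sub>s\<^esup>\<close>
  is encoded by the weight function \<open>wt\<close>: the \<open>j\<close>-th block consists of the coordinates
  \<open>i\<close> with \<open>wt i = j\<close>, and \<open>range wt = {1..s}\<close> says that the blocks
  \<open>1, \<dots>, s\<close> are exactly those occurring, none of them empty.  The map \<open>h\<close> enumerates
  the first block, so \<open>m = CARD('m)\<close>.  The stratification \<open>V\<^sub>1 \<oplus> \<dots> \<oplus> V\<^sub>s\<close> of the
  Lie algebra, with \<open>[V\<^sub>1, V\<^sub>j] = V\<^bsub>j+1\<^esub>\<close>, is a consequence of the dilation and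
  Hormander conditions.
\<close>

locale carnot_group =
  fixes G :: "(real^'n) monoid"
    and s :: nat
    and wt :: "'n::finite \<Rightarrow> nat"
    and h :: "'m::finite \<Rightarrow> 'n"
    and X :: "'m \<Rightarrow> real^'n \<Rightarrow> real^'n"
  assumes lie_group: "lie_group G"
    and one_eq_zero: "\<one>\<^bsub>G\<^esub> = 0"
    and weights: "range wt = {1..s}"
    and dilation_automorphism: "r > 0 \<Longrightarrow> dilation wt r \<in> iso G G"
    and first_layer: "bij_betw h UNIV {i. wt i = 1}"
    and X_left_invariant: "left_invariant G (X j)"
    and X_at_zero: "X j 0 = axis (h j) 1"
    and hormander: "hormander (range X)"

text \<open>\<open>horizontal X u\<close> is \<open>u \<cdot> X\<close>, so that \<open>V\<^sub>1 = range (horizontal X)\<close>.\<close>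

definition horizontal :: "('m::finite \<Rightarrow> real^'n \<Rightarrow> real^'n) \<Rightarrow> real^'m \<Rightarrow> real^'n \<Rightarrow> real^'n" where
  "horizontal X u = (\<lambda>x. \<Sum>j\<in>UNIV. u $ j *\<^sub>R X j x)"

text \<open>
  The Lie group exponential of a left-invariant field on a group with identity \<open>0\<close>; there the
  integral curve exists on \<open>{0..1}\<close> and is unique, so the description is proper.
\<close>

definition lie_exp :: "('a::euclidean_space \<Rightarrow> 'a) \<Rightarrow> 'a" where
  "lie_exp Z = (THE y. \<exists>\<gamma>. \<gamma> 0 = 0 \<and>
     (\<forall>t\<in>{0..1}. (\<gamma> has_vector_derivative Z (\<gamma> t)) (at t within {0..1})) \<and> \<gamma> 1 = y)"

text \<open>
  Points of \<open>(\<real>\<^sup>m)\<^sup>p\<close> are lists of length \<open>p\<close>, with the Euclidean distance of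
  \<open>\<real>\<^bsup>mp\<^esup>\<close>.
\<close>

definition multiexp ::
    "(real^'n) monoid \<Rightarrow> ('m::finite \<Rightarrow> real^'n \<Rightarrow> real^'n) \<Rightarrow> (real^'m) list \<Rightarrow> real^'n" where
  "multiexp G X us = foldr (\<lambda>u y. lie_exp (horizontal X u) \<otimes>\<^bsub>G\<^esub> y) us \<one>\<^bsub>G\<^esub>"

definition list_ball :: "(real^'m::finite) list \<Rightarrow> real \<Rightarrow> (real^'m) list set" where
  "list_ball us r = {vs. length vs = length us \<and>
     L2_set (\<lambda>i. dist (us ! i) (vs ! i)) {..<length us} < r}"

definition multiexp_locally_open_at ::
    "(real^'n) monoid \<Rightarrow> ('m::finite \<Rightarrow> real^'n \<Rightarrow> real^'n) \<Rightarrow> (real^'m) list \<Rightarrow> bool" where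
  "multiexp_locally_open_at G X us \<longleftrightarrow>
     (\<forall>\<epsilon>>0. \<exists>\<sigma>>0. ball (multiexp G X us) \<sigma> \<subseteq> multiexp G X ` list_ball us \<epsilon>)"


subsection \<open>The subRiemannian distance\<close>

definition horizontal_path ::
    "('m::finite \<Rightarrow> real^'n \<Rightarrow> real^'n) \<Rightarrow> real \<Rightarrow> real \<Rightarrow> (real \<Rightarrow> real^'n) \<Rightarrow> (real \<Rightarrow> real^'m) \<Rightarrow> bool" where
  "horizontal_path X a b \<gamma> u \<longleftrightarrow> a < b \<and> (\<exists>L. L-lipschitz_on {a..b} \<gamma>) \<and>
     set_integrable lebesgue {a<..<b} u \<and>
     (AE t in lebesgue. t \<in> {a<..<b} \<longrightarrow>
        (\<gamma> has_vector_derivative horizontal X (u t) (\<gamma> t)) (at t))"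

text \<open>
  The distance takes values in \<open>[0,\<infinity>]\<close>, the infimum over the empty set being
  \<open>\<infinity>\<close> (this does not occur in a Carnot group).
\<close>

definition sr_dist :: "('m::finite \<Rightarrow> real^'n \<Rightarrow> real^'n) \<Rightarrow> real^'n \<Rightarrow> real^'n \<Rightarrow> ennreal" where
  "sr_dist X x y = Inf {ennreal (set_lebesgue_integral lebesgue {a<..<b} (\<lambda>t. norm (u t))) |a b \<gamma> u.
     horizontal_path X a b \<gamma> u \<and> \<gamma> a = x \<and> \<gamma> b = y}"

definition sr_ball :: "('m::finite \<Rightarrow> real^'n \<Rightarrow> real^'n) \<Rightarrow> real^'n \<Rightarrow> real \<Rightarrow> (real^'n) set" where
  "sr_ball X x r = {y. sr_dist X x y < ennreal r}"


subsection \<open>Horizontal convexity\<close>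

definition horizontal_line ::
    "(real^'n) monoid \<Rightarrow> real^'n \<Rightarrow> (real^'n \<Rightarrow> real^'n) \<Rightarrow> real \<Rightarrow> real^'n" where
  "horizontal_line G x W t = x \<otimes>\<^bsub>G\<^esub> lie_exp (\<lambda>z. t *\<^sub>R W z)"

definition horizontally_convex ::
    "(real^'n) monoid \<Rightarrow> ('m::finite \<Rightarrow> real^'n \<Rightarrow> real^'n) \<Rightarrow> (real^'n) set \<Rightarrow> bool" where
  "horizontally_convex G X A \<longleftrightarrow>
     (\<forall>x. \<forall>W\<in>range (horizontal X). \<forall>a b.
        horizontal_line G x W a \<in> A \<longrightarrow> horizontal_line G x W b \<in> A \<longrightarrow>
        horizontal_line G x W ` {a..b} \<subseteq> A)"

end

theory Submission
  imports Defs
begin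

text \<open>
  Write \<open>E u\<close> for the exponential of \<open>u \<cdot> X\<close> and \<open>\<delta> r\<close> for the dilations.  The idea is that
  a broken horizontal line of total time at most 1, starting in \<open>A\<close> near \<open>xbar\<close> with directions near \<open>\<xi>\<close>, cannot leave
  \<open>A\<close>.  Suppose a point \<open>y \<in> A\<close> is close to \<open>xbar \<cdot> E (\<sigma> \<xi>)\<close> and \<open>u\<close> is close to \<open>\<xi>\<close>.  Then
  \<open>y \<cdot> E ((1 - \<sigma>) u)\<close> is close to \<open>xbar \<cdot> E \<xi>\<close>, an interior point of \<open>A\<close>, and so lies in \<open>A\<close>;
  horizontal convexity puts the whole segment from \<open>y\<close> to this point into \<open>A\<close>.  Walking along it for a
  time \<open>\<tau> \<le> 1 - \<sigma>\<close> leads to a point of \<open>A\<close> close to \<open>xbar \<cdot> E ((\<sigma> + \<tau>) \<xi>)\<close>, and the argument can be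
  repeated (\<open>step_stays_in_A\<close>).  After \<open>p\<close> steps of length \<open>t / p\<close> this gives
  \<open>x \<cdot> \<Gamma> (t/p u\<^sub>1, \<dots>, t/p u\<^sub>p) \<in> A\<close> for all \<open>x \<in> A\<close> near \<open>xbar\<close>, all \<open>u\<^sub>i\<close> near \<open>\<xi>\<close> and all
  \<open>t \<in> (0, 1]\<close> (\<open>multiexp_stays_in_A\<close>), with a closeness that does not depend on \<open>t\<close>.
  
  Since \<open>\<Gamma> (r u\<^sub>1, \<dots>, r u\<^sub>p) = \<delta> r (\<Gamma> (u\<^sub>1, \<dots>, u\<^sub>p))\<close>, local openness of \<open>\<Gamma>\<close> turns this into:
  \<open>A\<close> contains \<open>x \<cdot> \<delta> (t/p) U\<close>, where \<open>U\<close> is a fixed Euclidean ball around \<open>\<Gamma> (\<xi>, \<dots>, \<xi>) = E (p \<xi>)\<close>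
  (\<open>dilated_ball_subset_A\<close>).  This set is an open neighbourhood of \<open>x \<cdot> E (t \<xi>)\<close>, and
  because the distance is left-invariant and homogeneous it contains a subRiemannian ball of radius
  proportional to \<open>t\<close> (\<open>sr_dist_small_imp_norm_small\<close>).  A point of the closure of \<open>A\<close> is handled by
  replacing it with a sufficiently close point of \<open>A\<close>.
  
  All facts about flows come from one observation: the \<open>i\<close>-th component of \<open>X j\<close> is homogeneous of
  degree \<open>wt i - 1\<close> and continuously differentiable, so it depends only on coordinates of weight less
  than \<open>wt i\<close> (\<open>X_triangular\<close>).  The equation for integral curves is therefore triangular: it is solved
  weight by weight, which gives uniqueness, and Picard iteration becomes stationary after finitely many
  steps, which gives existence and continuity in \<open>u\<close>.
\<close>

section \<open>Lipschitz curves and C1 maps\<close>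

text \<open>
  The difference quotients of a Lipschitz curve are bounded by its Lipschitz constant and converge to
  the derivative almost everywhere, so dominated convergence gives the integral of the derivative.  The
  integrals of the quotients are in turn quotients of an antiderivative of the curve at the two end
  points, and tend to the values of the curve there.
\<close>

lemma lipschitz_curve_FTC:
  fixes \<gamma> :: "real \<Rightarrow> 'a::euclidean_space"
  assumes "a \<le> b" and lip: "L-lipschitz_on {a..b} \<gamma>" and N: "negligible N"
    and der: "\<And>t. t \<in> {a<..<b} - N \<Longrightarrow> (\<gamma> has_vector_derivative D t) (at t)"
  shows "(D has_integral (\<gamma> b - \<gamma> a)) {a..b}"
proof -
  have L: "L \<ge> 0" using lip by (rule lipschitz_on_nonneg)
  \<comment> \<open>The extension by constants makes the quotients near the right end point meaningful.\<close>
  define c where "c t = \<gamma> (max a (min b t))" for t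
  have cL: "norm (c t - c r) \<le> L * \<bar>t - r\<bar>" for t r
  proof -
    have "dist (c t) (c r) \<le> L * dist (max a (min b t)) (max a (min b r))"
      unfolding c_def using lip \<open>a \<le> b\<close> by (intro lipschitz_onD) auto
    also have "\<dots> \<le> L * \<bar>t - r\<bar>"
      using L by (intro mult_left_mono) (auto simp: dist_real_def)
    finally show ?thesis by (simp add: dist_norm)
  qed
  have "L-lipschitz_on UNIV c"
    using cL L by (intro lipschitz_onI) (auto simp: dist_norm)
  then have contc: "continuous_on T c" for T
    by (meson continuous_on_subset lipschitz_on_continuous_on subset_UNIV)
  \<comment> \<open>Starting at \<open>a - 1\<close> makes \<open>a\<close> an interior point, so \<open>P\<close> has a two-sided derivative there.\<close>
  define P where "P t = integral {a-1..t} c" for t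
  have P: "(P has_vector_derivative c t) (at t)" if "a - 1 < t" "t < b + 2" for t
  proof -
    have "((\<lambda>t. integral {a-1..t} c) has_vector_derivative c t) (at t within {a-1..b+2})"
      by (rule integral_has_vector_derivative[OF contc]) (use that in auto)
    then show ?thesis
      unfolding P_def using that by (subst (asm) at_within_interior) auto
  qed
  define e where "e n = inverse (real (Suc n))" for n
  have e: "e n > 0" "e n \<le> 1" "e n * real (Suc n) = 1" for n
    unfolding e_def by (auto simp: divide_simps)
  have e0: "e \<longlonglongrightarrow> 0" unfolding e_def by (rule LIMSEQ_inverse_real_of_nat)
  have quot: "(\<lambda>n. (f (t + e n) - f t) /\<^sub>R e n) \<longlonglongrightarrow> d"
    if "(f has_vector_derivative d) (at t)" for f :: "real \<Rightarrow> 'a" and t d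
  proof -
    have "((\<lambda>h. (f (t + h) - f t) /\<^sub>R h) \<longlongrightarrow> d) (at 0)"
    proof -
      have "((\<lambda>h. norm (f (t + h) - f t - h *\<^sub>R d) / norm h) \<longlongrightarrow> 0) (at 0)"
        using that by (simp add: has_vector_derivative_def has_derivative_at)
      then have "((\<lambda>h. norm ((f (t + h) - f t) /\<^sub>R h - d)) \<longlongrightarrow> 0) (at 0)"
      proof (rule Lim_transform_eventually)
        show "\<forall>\<^sub>F h in at 0. norm (f (t + h) - f t - h *\<^sub>R d) / norm h
                = norm ((f (t + h) - f t) /\<^sub>R h - d)"
          unfolding eventually_at_filter
        proof (intro always_eventually allI impI)
          fix h :: real assume "h \<noteq> 0"
          then have "(f (t + h) - f t) /\<^sub>R h - d = (f (t + h) - f t - h *\<^sub>R d) /\<^sub>R h"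
            by (simp add: scaleR_right_diff_distrib)
          then show "norm (f (t + h) - f t - h *\<^sub>R d) / norm h
                = norm ((f (t + h) - f t) /\<^sub>R h - d)"
            by (simp add: divide_inverse)
        qed
      qed
      then show ?thesis
        using Lim_null tendsto_norm_zero_iff by blast
    qed
    moreover have "filterlim e (at 0) sequentially"
      using e0 e(1) by (auto simp: filterlim_at intro!: always_eventually) (metis less_irrefl)
    ultimately show ?thesis
      by (rule filterlim_compose)
  qed
  define q where "q n t = (c (t + e n) - c t) /\<^sub>R e n" for n t
  have Iq: "(q n has_integral ((P (b + e n) - P b) /\<^sub>R e n - (P (a + e n) - P a) /\<^sub>R e n)) {a..b}" for n
  proof -
    have "((\<lambda>t. (P (t + e n) - P t) /\<^sub>R e n) has_vector_derivative q n t) (at t within {a..b})"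
      if "t \<in> {a..b}" for t
    proof -
      have "((P \<circ> (\<lambda>t. t + e n)) has_vector_derivative 1 *\<^sub>R c (t + e n)) (at t)"
        using that e(1,2)[of n]
        by (intro vector_diff_chain_at P) (auto intro!: derivative_eq_intros)
      moreover have "(P has_vector_derivative c t) (at t)"
        using that by (intro P) auto
      ultimately have "((\<lambda>t. (P (t + e n) - P t) /\<^sub>R e n) has_vector_derivative q n t) (at t)"
        unfolding q_def o_def
        by (auto intro!: derivative_eq_intros simp: scaleR_right_diff_distrib)
      then show ?thesis by (rule has_vector_derivative_at_within)
    qed
    from fundamental_theorem_of_calculus[OF \<open>a \<le> b\<close> this]
    show ?thesis by (simp add: algebra_simps)
  qed
  define N' where "N' = insert a (insert b N)"
  have N': "negligible N'" using N by (simp add: N'_def)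
  define q' where "q' n t = (if t \<in> N' then 0 else q n t)" for n t
  define D' where "D' t = (if t \<in> N' then 0 else D t)" for t
  have Iq': "(q' n has_integral ((P (b + e n) - P b) /\<^sub>R e n - (P (a + e n) - P a) /\<^sub>R e n)) {a..b}" for n
    by (rule has_integral_spike[OF N' _ Iq]) (auto simp: q'_def)
  have dom: "norm (q' n t) \<le> L" for n t
  proof -
    have "norm (c (t + e n) - c t) \<le> L * e n"
      using cL[of "t + e n" t] e(1)[of n] by simp
    then have "norm (q n t) \<le> L"
      using e(1)[of n] by (simp add: q_def divide_simps mult.commute)
    then show ?thesis using L by (simp add: q'_def)
  qed
  have conv: "(\<lambda>n. q' n t) \<longlonglongrightarrow> D' t" if "t \<in> {a..b}" for t
  proof (cases "t \<in> N'")
    case False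
    then have t: "t \<in> {a<..<b} - N" using that by (auto simp: N'_def)
    have "(c has_vector_derivative D t) (at t)"
    proof (rule has_vector_derivative_transform_within_open[OF der[OF t], of "{a<..<b}"])
      show "\<gamma> x = c x" if "x \<in> {a<..<b}" for x using that by (simp add: c_def)
    qed (use t in auto)
    from quot[OF this] show ?thesis using False by (simp add: q'_def D'_def q_def)
  qed (simp add: q'_def D'_def)
  have D'i: "D' integrable_on {a..b}" and lim: "(\<lambda>n. integral {a..b} (q' n)) \<longlonglongrightarrow> integral {a..b} D'"
    using dominated_convergence[of q' "{a..b}" "\<lambda>_. L" D'] Iq' dom conv
    by (auto intro: has_integral_integrable)
  have "(\<lambda>n. integral {a..b} (q' n)) \<longlonglongrightarrow> c b - c a"
    unfolding integral_unique[OF Iq']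
    by (intro tendsto_diff quot P) (use \<open>a \<le> b\<close> in auto)
  with lim have "integral {a..b} D' = c b - c a" by (rule LIMSEQ_unique)
  then have "(D' has_integral (c b - c a)) {a..b}" using D'i by (simp add: has_integral_iff)
  then have "(D has_integral (c b - c a)) {a..b}"
    by (rule has_integral_spike[OF N', rotated]) (auto simp: D'_def)
  then show ?thesis using \<open>a \<le> b\<close> by (simp add: c_def)
qed

lemma lipschitz_curve_norm_bound:
  fixes \<gamma> :: "real \<Rightarrow> 'a::euclidean_space"
  assumes "a \<le> b" and lip: "L-lipschitz_on {a..b} \<gamma>" and N: "negligible N"
    and der: "\<And>t. t \<in> {a<..<b} - N \<Longrightarrow> (\<gamma> has_vector_derivative D t) (at t)"
    and bound: "\<And>t. t \<in> {a<..<b} - N \<Longrightarrow> norm (D t) \<le> g t"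
    and g: "g integrable_on {a..b}" "\<And>t. g t \<ge> 0"
  shows "norm (\<gamma> b - \<gamma> a) \<le> integral {a..b} g"
proof -
  define N' where "N' = insert a (insert b N)"
  have N': "negligible N'" using N by (simp add: N'_def)
  define D' where "D' t = (if t \<in> N' then 0 else D t)" for t
  have "(D' has_integral (\<gamma> b - \<gamma> a)) {a..b}"
    by (rule has_integral_spike[OF N' _ lipschitz_curve_FTC[OF assms(1-4)]]) (auto simp: D'_def)
  then have "D' integrable_on {a..b}" "integral {a..b} D' = \<gamma> b - \<gamma> a"
    by (auto simp: has_integral_iff)
  moreover have "norm (D' t) \<le> g t" if "t \<in> {a..b}" for t
    using bound[of t] g(2)[of t] that by (auto simp: D'_def N'_def)
  ultimately show ?thesis
    using integral_norm_bound_integral[of D' "{a..b}" g] g(1) by simp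
qed

lemma C1_lipschitz_on_cball:
  fixes f :: "'a::euclidean_space \<Rightarrow> 'b::real_normed_vector"
  assumes der: "\<And>x. (f has_derivative f' x) (at x)"
    and cont: "\<And>v. continuous_on UNIV (\<lambda>x. f' x v)"
  shows "\<exists>L. L-lipschitz_on (cball 0 R) f"
proof -
  have "continuous_on (cball 0 R) (\<lambda>x. \<Sum>b\<in>Basis. norm (f' x b))"
    by (intro continuous_intros continuous_on_subset[OF cont]) auto
  then have "bounded ((\<lambda>x. \<Sum>b\<in>Basis. norm (f' x b)) ` cball 0 R)"
    by (intro compact_imp_bounded compact_continuous_image) auto
  then obtain B where B: "\<And>x. x \<in> cball 0 R \<Longrightarrow> \<bar>\<Sum>b\<in>Basis. norm (f' x b)\<bar> \<le> B"
    unfolding bounded_iff by (metis image_eqI real_norm_def)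
  have on: "onorm (f' x) \<le> max B 0" if "x \<in> cball 0 R" for x
  proof (rule onorm_le)
    fix v
    have lin: "bounded_linear (f' x)" using der has_derivative_bounded_linear by blast
    have "f' x v = f' x (\<Sum>b\<in>Basis. (v \<bullet> b) *\<^sub>R b)" by (simp add: euclidean_representation)
    also have "\<dots> = (\<Sum>b\<in>Basis. (v \<bullet> b) *\<^sub>R f' x b)"
      using lin by (simp add: bounded_linear.linear linear_sum linear_cmul)
    also have "norm \<dots> \<le> (\<Sum>b\<in>Basis. norm v * norm (f' x b))"
      by (intro sum_norm_le) (auto intro!: mult_right_mono Basis_le_norm)
    also have "\<dots> = (\<Sum>b\<in>Basis. norm (f' x b)) * norm v"
      by (simp add: sum_distrib_left mult.commute)
    also have "\<dots> \<le> max B 0 * norm v"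
      using B[OF that] by (intro mult_right_mono) auto
    finally show "norm (f' x v) \<le> max B 0 * norm v" .
  qed
  have "norm (f x - f y) \<le> max B 0 * norm (x - y)" if "x \<in> cball 0 R" "y \<in> cball 0 R" for x y
    by (rule differentiable_bound[OF convex_cball _ on])
       (use that der has_derivative_at_withinI in blast)+
  then have "(max B 0)-lipschitz_on (cball 0 R) f"
    by (intro lipschitz_onI) (auto simp: dist_norm)
  then show ?thesis ..
qed

lemma C1_D:
  assumes "C_k (Suc 0) f"
  obtains f' where "\<And>x. (f has_derivative f' x) (at x)" "\<And>v. continuous_on UNIV (\<lambda>x. f' x v)"
  using assms by auto


lemma C1_I:
  assumes "\<And>x. (f has_derivative f' x) (at x)" "\<And>v. continuous_on UNIV (\<lambda>x. f' x v)"
  shows "C_k (Suc 0) f"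
  using assms by auto

section \<open>Dilations and homogeneous functions\<close>

lemma linear_dilation: "linear (dilation wt r)"
  by (rule linearI) (auto simp: dilation_def vec_eq_iff algebra_simps)

lemma dilation_has_derivative: "(dilation wt r has_derivative dilation wt r) F"
  by (intro bounded_linear_imp_has_derivative linear_dilation[unfolded linear_conv_bounded_linear])

lemma continuous_on_dilation: "continuous_on S (dilation wt r)"
  by (rule linear_continuous_on[OF linear_dilation[unfolded linear_conv_bounded_linear]])

lemma dilation_axis: "dilation wt r (axis l c) = axis l (r ^ wt l * c)"
  by (auto simp: dilation_def axis_def vec_eq_iff)

lemma dilation_1 [simp]: "dilation wt 1 x = x"
  by (simp add: dilation_def vec_eq_iff)

lemma dilation_dilation: "dilation wt r (dilation wt q x) = dilation wt (r * q) x"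
  by (simp add: dilation_def vec_eq_iff power_mult_distrib)

lemma vec_eq_sum_axis: "(v :: real^'n) = (\<Sum>l\<in>UNIV. (v $ l) *\<^sub>R axis l 1)"
  by (simp add: vec_eq_iff axis_def if_distrib sum.delta cong: if_cong)

text \<open>
  The hypothesis says that \<open>f\<close> is homogeneous of degree \<open>k - 1\<close>.  A partial derivative in a direction of
  weight at least \<open>k\<close> is then homogeneous of negative degree; being continuous at \<open>0\<close>, it must vanish.
\<close>

lemma homogeneous_C1_partial_zero:
  fixes f :: "real^'n \<Rightarrow> real" and wt :: "'n::finite \<Rightarrow> nat"
  assumes f': "\<And>x. (f has_derivative f' x) (at x)" "\<And>v. continuous_on UNIV (\<lambda>x. f' x v)"
    and hom: "\<And>r x. r > 0 \<Longrightarrow> r * f (dilation wt r x) = r ^ k * f x"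
    and l: "k \<le> wt l"
  shows "f' x (axis l 1) = 0"
proof -
  have scal: "f' x (axis l 1) = r ^ (Suc (wt l) - k) * f' (dilation wt r x) (axis l 1)" if "r > 0" for r
  proof -
    have "((\<lambda>x. r * f (dilation wt r x)) has_derivative (\<lambda>v. r * f' (dilation wt r x) (dilation wt r v))) (at x)"
      by (intro has_derivative_mult_right has_derivative_compose[OF dilation_has_derivative f'(1)])
    moreover have "((\<lambda>x. r * f (dilation wt r x)) has_derivative (\<lambda>v. r ^ k * f' x v)) (at x)"
      unfolding hom[OF that] by (intro has_derivative_mult_right f'(1))
    ultimately have "r * f' (dilation wt r x) (dilation wt r (axis l 1)) = r ^ k * f' x (axis l 1)"
      by (metis has_derivative_unique)
    moreover have "dilation wt r (axis l 1) = (r ^ wt l) *\<^sub>R axis l 1"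
      by (simp add: dilation_axis) (simp add: axis_def vec_eq_iff)
    ultimately have "r ^ Suc (wt l) * f' (dilation wt r x) (axis l 1) = r ^ k * f' x (axis l 1)"
      using linear_cmul[OF has_derivative_linear[OF f'(1)]] by (simp add: mult.assoc)
    moreover have "r ^ Suc (wt l) = r ^ k * r ^ (Suc (wt l) - k)"
      using l by (simp flip: power_add)
    ultimately have "r ^ k * (r ^ (Suc (wt l) - k) * f' (dilation wt r x) (axis l 1)) = r ^ k * f' x (axis l 1)"
      by (metis mult.assoc)
    then show ?thesis using that by simp
  qed
  define e where "e n = inverse (real (Suc n))" for n
  have e: "e n > 0" for n by (simp add: e_def)
  have e0: "e \<longlonglongrightarrow> 0" unfolding e_def by (rule LIMSEQ_inverse_real_of_nat)
  have "(\<lambda>n. dilation wt (e n) x) \<longlonglongrightarrow> dilation wt 0 x"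
    unfolding dilation_def by (intro vec_tendstoI) (auto intro!: tendsto_intros e0)
  then have "(\<lambda>n. f' (dilation wt (e n) x) (axis l 1)) \<longlonglongrightarrow> f' (dilation wt 0 x) (axis l 1)"
    using continuous_on_tendsto_compose[OF f'(2)] by auto
  then have "(\<lambda>n. e n ^ (Suc (wt l) - k) * f' (dilation wt (e n) x) (axis l 1))
      \<longlonglongrightarrow> 0 ^ (Suc (wt l) - k) * f' (dilation wt 0 x) (axis l 1)"
    by (intro tendsto_intros e0)
  then have "(\<lambda>n. f' x (axis l 1)) \<longlonglongrightarrow> 0"
    using l by (simp add: power_0_left flip: scal[OF e])
  then show ?thesis by (simp add: LIMSEQ_const_iff)
qed

lemma homogeneous_C1_depends_on_lower_weights:
  fixes f :: "real^'n \<Rightarrow> real" and wt :: "'n::finite \<Rightarrow> nat"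
  assumes "C_k (Suc 0) f"
    and hom: "\<And>r x. r > 0 \<Longrightarrow> r * f (dilation wt r x) = r ^ k * f x"
    and eq: "\<And>l. wt l < k \<Longrightarrow> x $ l = y $ l"
  shows "f x = f y"
proof -
  obtain f' where f': "\<And>x. (f has_derivative f' x) (at x)" "\<And>v. continuous_on UNIV (\<lambda>x. f' x v)"
    using C1_D[OF assms(1)] by blast
  have zero: "f' z (y - x) = 0" for z
  proof -
    have lin: "linear (f' z)" using f'(1) by (rule has_derivative_linear)
    have "f' z (y - x) = f' z (\<Sum>l\<in>UNIV. ((y - x) $ l) *\<^sub>R axis l 1)"
      by (subst vec_eq_sum_axis) simp
    also have "\<dots> = (\<Sum>l\<in>UNIV. ((y - x) $ l) *\<^sub>R f' z (axis l 1))"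
      using lin by (simp add: linear_sum linear_cmul)
    also have "\<dots> = 0"
    proof (intro sum.neutral ballI)
      fix l
      show "((y - x) $ l) *\<^sub>R f' z (axis l 1) = 0"
        using eq[of l] homogeneous_C1_partial_zero[OF f' hom, of l] by (cases "wt l < k") auto
    qed
    finally show ?thesis .
  qed
  have "((\<lambda>t::real. f (x + t *\<^sub>R (y - x))) has_derivative (\<lambda>_. 0)) (at t within UNIV)" for t
  proof -
    have "((\<lambda>t::real. f (x + t *\<^sub>R (y - x))) has_derivative (\<lambda>r. f' (x + t *\<^sub>R (y - x)) (r *\<^sub>R (y - x)))) (at t)"
      by (rule has_derivative_compose[OF _ f'(1)]) (auto intro!: derivative_eq_intros)
    then show ?thesis
      using linear_cmul[OF has_derivative_linear[OF f'(1)]] zero by simp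
  qed
  from has_derivative_zero_constant[OF convex_UNIV this]
  obtain c where "\<And>t::real. f (x + t *\<^sub>R (y - x)) = c" by auto
  from this[of 0] this[of 1] show ?thesis by simp
qed

section \<open>Horizontal fields of a Carnot group\<close>

lemma horizontal_scale: "horizontal X (c *\<^sub>R u) = (\<lambda>x. c *\<^sub>R horizontal X u x)"
  by (simp add: horizontal_def scaleR_sum_right fun_eq_iff)

lemma horizontal_zero: "horizontal X 0 = (\<lambda>x. 0)"
  by (simp add: horizontal_def fun_eq_iff)

context carnot_group
begin

abbreviation mult (infixl "\<cdot>" 70) where "x \<cdot> y \<equiv> x \<otimes>\<^bsub>G\<^esub> y"
abbreviation \<delta> where "\<delta> \<equiv> dilation wt"

lemma group_G: "group G" and carrier_G [simp]: "carrier G = UNIV"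
  using lie_group by (auto simp: lie_group_def)

lemma G_assoc: "(x \<cdot> y) \<cdot> z = x \<cdot> (y \<cdot> z)"
  and G_one [simp]: "0 \<cdot> x = x" "x \<cdot> 0 = x"
  and G_inv [simp]: "inv\<^bsub>G\<^esub> x \<cdot> x = 0" "x \<cdot> inv\<^bsub>G\<^esub> x = 0"
  using group_G one_eq_zero group.is_monoid[OF group_G] monoid.m_assoc[of G x y z]
    monoid.l_one[of G x] monoid.r_one[of G x] group.l_inv[of G x] group.r_inv[of G x]
  by auto

lemma G_cancel [simp]: "inv\<^bsub>G\<^esub> x \<cdot> (x \<cdot> y) = y" "x \<cdot> (inv\<^bsub>G\<^esub> x \<cdot> y) = y"
  by (simp_all flip: G_assoc)

lemma dilation_mult: "r > 0 \<Longrightarrow> \<delta> r (x \<cdot> y) = \<delta> r x \<cdot> \<delta> r y"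
  using dilation_automorphism[of r] by (auto simp: iso_def hom_def)

lemma dilation_zero [simp]: "\<delta> r 0 = 0"
  by (simp add: dilation_def vec_eq_iff)

lemma wt_pos: "wt i \<ge> 1" and wt_le: "wt i \<le> s"
  using weights by auto

lemma wt_h [simp]: "wt (h j) = 1"
  using first_layer by (auto simp: bij_betw_def)

lemma mult_C2:
  obtains M where "\<And>z. ((\<lambda>(x, y). x \<cdot> y) has_derivative M z) (at z)"
    "\<And>v. C_k (Suc 0) (\<lambda>z. M z v)"
proof -
  have "C_k (Suc (Suc 0)) (\<lambda>(x, y). x \<cdot> y)"
    using lie_group by (auto simp: lie_group_def smooth_def)
  then show ?thesis using that by (auto simp del: C_k.simps(1))
qed

lemma continuous_mult: "continuous_on UNIV (\<lambda>(x, y). x \<cdot> y)"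
  using mult_C2 by (metis has_derivative_continuous continuous_at_imp_continuous_on)

lemma continuous_on_mult' [continuous_intros]:
  "continuous_on S f \<Longrightarrow> continuous_on S g \<Longrightarrow> continuous_on S (\<lambda>x. f x \<cdot> g x)"
  using continuous_on_compose2[OF continuous_mult, of S "\<lambda>x. (f x, g x)"]
  by (auto intro: continuous_on_Pair)

lemma continuous_on_inv' [continuous_intros]:
  "continuous_on S f \<Longrightarrow> continuous_on S (\<lambda>x. inv\<^bsub>G\<^esub> (f x))"
proof -
  have "C_k 0 (\<lambda>x. inv\<^bsub>G\<^esub> x)" using lie_group unfolding lie_group_def smooth_def by blast
  then show "continuous_on S f \<Longrightarrow> continuous_on S (\<lambda>x. inv\<^bsub>G\<^esub> (f x))"
    by (auto intro: continuous_on_compose2)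
qed

lemma left_translation_derivative:
  obtains T where "\<And>z. ((\<lambda>z. c \<cdot> z) has_derivative T z) (at z)"
    "\<And>v. continuous_on UNIV (\<lambda>z. T z v)"
    "\<And>u z. T z (horizontal X u z) = horizontal X u (c \<cdot> z)"
proof -
  obtain M where M: "\<And>z. ((\<lambda>(x, y). x \<cdot> y) has_derivative M z) (at z)"
    and M': "\<And>v. C_k (Suc 0) (\<lambda>z. M z v)" using mult_C2 by blast
  define T where "T z v = M (c, z) (0, v)" for z v
  have T: "((\<lambda>z. c \<cdot> z) has_derivative T z) (at z)" for z
  proof -
    have "((\<lambda>z. (c, z)) has_derivative (\<lambda>v. (0, v))) (at z)"
      by (auto intro!: derivative_eq_intros)
    from has_derivative_compose[OF this M] show ?thesis by (simp add: T_def[abs_def])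
  qed
  have "continuous_on UNIV (\<lambda>z. T z v)" for v
  proof -
    have "continuous_on UNIV (\<lambda>z. M z (0, v))"
      using C1_D[OF M'] by (metis has_derivative_continuous continuous_at_imp_continuous_on)
    moreover have "continuous_on UNIV (\<lambda>z. (c, z))"
      by (intro continuous_on_Pair continuous_on_const continuous_on_id)
    ultimately show ?thesis
      unfolding T_def by (rule continuous_on_compose2) auto
  qed
  moreover have "T z (horizontal X u z) = horizontal X u (c \<cdot> z)" for u z
  proof -
    have "T z (X j z) = X j (c \<cdot> z)" for j
      using X_left_invariant[of j] frechet_derivative_at[OF T] by (simp add: left_invariant_def)
    then show ?thesis
      using has_derivative_linear[OF T]
      by (simp add: horizontal_def linear_sum linear_cmul)
  qed
  ultimately show ?thesis using that[OF T] by blast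
qed

text \<open>
  By left-invariance \<open>X j x\<close> is the partial derivative of the multiplication at \<open>(x, 0)\<close> in a fixed
  direction of the second factor, so the smoothness of the group law passes on to the field.
\<close>

lemma X_C1: "C_k (Suc 0) (X j)"
proof -
  obtain M where M: "\<And>z. ((\<lambda>(x, y). x \<cdot> y) has_derivative M z) (at z)"
    and M': "\<And>v. C_k (Suc 0) (\<lambda>z. M z v)" using mult_C2 by blast
  define e where "e = (0 :: real^'n, axis (h j) 1 :: real^'n)"
  have X: "X j x = M (x, 0) e" for x
  proof -
    have "((\<lambda>z. (x, z)) has_derivative (\<lambda>v. (0, v))) (at 0)"
      by (auto intro!: derivative_eq_intros)
    from has_derivative_compose[OF this M]
    have "((\<lambda>z. x \<cdot> z) has_derivative (\<lambda>v. M (x, 0) (0, v))) (at 0)" by simp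
    then have "frechet_derivative (\<lambda>z. x \<cdot> z) (at 0) = (\<lambda>v. M (x, 0) (0, v))"
      by (rule frechet_derivative_at[symmetric])
    then have "frechet_derivative (\<lambda>z. x \<cdot> z) (at 0) (X j 0) = M (x, 0) e"
      by (simp add: X_at_zero e_def)
    then show ?thesis
      using X_left_invariant[of j] unfolding left_invariant_def by (metis G_one(2))
  qed
  obtain N where N: "\<And>x. ((\<lambda>z. M z e) has_derivative N x) (at x)"
    "\<And>v. continuous_on UNIV (\<lambda>x. N x v)"
    using C1_D[OF M'] by metis
  have "(X j has_derivative (\<lambda>v. N (x, 0) (v, 0))) (at x)" for x
  proof -
    have "((\<lambda>x. (x, 0)) has_derivative (\<lambda>v. (v, 0))) (at x)"
      by (auto intro!: derivative_eq_intros)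
    from has_derivative_compose[OF this N(1)] show ?thesis by (simp flip: X)
  qed
  moreover have "continuous_on UNIV (\<lambda>x. N (x, 0) (v, 0))" for v
    by (rule continuous_on_compose2[OF N(2), of UNIV "\<lambda>x. (x, 0)"]) (auto intro!: continuous_intros)
  ultimately show ?thesis by (rule C1_I)
qed

lemma continuous_X: "continuous_on UNIV (X j)"
  using C1_D[OF X_C1] by (metis has_derivative_continuous continuous_at_imp_continuous_on)

lemma dilation_X: assumes "r > 0" shows "\<delta> r (X j x) = r *\<^sub>R X j (\<delta> r x)"
proof -
  obtain T where T: "\<And>z. ((\<lambda>z. x \<cdot> z) has_derivative T z) (at z)"
    "\<And>u z. T z (horizontal X u z) = horizontal X u (x \<cdot> z)"
    using left_translation_derivative[of x] by metis
  obtain U where U: "\<And>z. ((\<lambda>z. \<delta> r x \<cdot> z) has_derivative U z) (at z)"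
    "\<And>u z. U z (horizontal X u z) = horizontal X u (\<delta> r x \<cdot> z)"
    using left_translation_derivative[of "\<delta> r x"] by metis
  \<comment> \<open>Differentiating \<open>\<delta> r (x \<cdot> z) = \<delta> r x \<cdot> \<delta> r z\<close> at \<open>z = 0\<close> compares the two values of \<open>X j\<close>.\<close>
  have hj: "horizontal X (axis j 1) = X j"
    by (auto simp: horizontal_def fun_eq_iff axis_def if_distrib if_distribR sum.delta cong: if_cong)
  have "((\<lambda>z. \<delta> r (x \<cdot> z)) has_derivative (\<lambda>v. \<delta> r (T 0 v))) (at 0)"
    by (rule has_derivative_compose[OF T(1) dilation_has_derivative])
  moreover have "((\<lambda>z. \<delta> r x \<cdot> \<delta> r z) has_derivative (\<lambda>v. U 0 (\<delta> r v))) (at 0)"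
    using has_derivative_compose[OF dilation_has_derivative U(1), of wt r 0] by simp
  ultimately have "\<delta> r (T 0 (X j 0)) = U 0 (\<delta> r (X j 0))"
    using dilation_mult[OF assms] has_derivative_unique by (metis (no_types, lifting) ext)
  moreover have "\<delta> r (X j 0) = r *\<^sub>R X j 0"
    by (simp add: X_at_zero dilation_axis) (simp add: axis_def vec_eq_iff)
  moreover have "T 0 (X j 0) = X j x" "U 0 (X j 0) = X j (\<delta> r x)"
    using T(2)[of 0 "axis j 1"] U(2)[of 0 "axis j 1"] by (simp_all add: hj)
  ultimately show ?thesis
    using linear_cmul[OF has_derivative_linear[OF U(1)]] by metis
qed

lemma dilation_horizontal:
  "r > 0 \<Longrightarrow> \<delta> r (horizontal X u x) = horizontal X (r *\<^sub>R u) (\<delta> r x)"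
  by (simp add: horizontal_def linear_sum[OF linear_dilation] linear_cmul[OF linear_dilation]
      dilation_X mult.commute)

lemma X_triangular:
  assumes "\<And>l. wt l < wt i \<Longrightarrow> x $ l = y $ l"
  shows "X j x $ i = X j y $ i"
proof (rule homogeneous_C1_depends_on_lower_weights[of "\<lambda>x. X j x $ i" wt "wt i"])
  obtain X' where X': "\<And>x. (X j has_derivative X' x) (at x)" "\<And>v. continuous_on UNIV (\<lambda>x. X' x v)"
    using C1_D[OF X_C1] by blast
  have "((\<lambda>x. X j x $ i) has_derivative (\<lambda>v. X' x v $ i)) (at x)" for x
    by (rule bounded_linear.has_derivative[OF bounded_linear_vec_nth X'(1)])
  moreover have "continuous_on UNIV (\<lambda>x. X' x v $ i)" for v
    by (intro continuous_intros X'(2))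
  ultimately show "C_k (Suc 0) (\<lambda>x. X j x $ i)" by (rule C1_I)
  fix r :: real and x assume "r > 0"
  from dilation_X[OF this, of j x]
  show "r * X j (\<delta> r x) $ i = r ^ wt i * X j x $ i"
    by (auto simp: dilation_def vec_eq_iff)
qed (rule assms)

lemma horizontal_triangular:
  assumes "\<And>l. wt l < wt i \<Longrightarrow> x $ l = y $ l"
  shows "horizontal X u x $ i = horizontal X u y $ i"
  using X_triangular[OF assms] by (simp add: horizontal_def)

lemma continuous_horizontal: "continuous_on UNIV (\<lambda>(u, x). horizontal X u x)"
  unfolding horizontal_def split_beta
  by (intro continuous_intros continuous_on_compose2[OF continuous_X]) auto


section \<open>The exponential map on the horizontal layer\<close>

definition integral_curve :: "real^'m \<Rightarrow> (real \<Rightarrow> real^'n) \<Rightarrow> bool" where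
  "integral_curve u \<gamma> \<longleftrightarrow>
     (\<forall>t\<in>{0..1}. (\<gamma> has_vector_derivative horizontal X u (\<gamma> t)) (at t within {0..1}))"

text \<open>
  By triangularity the derivative of the \<open>i\<close>-th component involves only components of smaller weight,
  so two curves with the same start agree by induction on the weight.
\<close>

lemma integral_curve_unique:
  assumes "integral_curve u \<gamma>" "integral_curve u \<zeta>" "\<gamma> 0 = \<zeta> 0" "t \<in> {0..1}"
  shows "\<gamma> t = \<zeta> t"
proof -
  have "\<forall>t\<in>{0..1}. \<gamma> t $ i = \<zeta> t $ i" for i
  proof (induction "wt i" arbitrary: i rule: less_induct)
    case less
    have "((\<lambda>t. \<gamma> t $ i - \<zeta> t $ i) has_vector_derivative 0) (at t within {0..1})"
      if "t \<in> {0..1}" for t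
    proof -
      have "horizontal X u (\<gamma> t) $ i = horizontal X u (\<zeta> t) $ i"
        by (rule horizontal_triangular) (use less that in blast)
      moreover have "((\<lambda>t. \<gamma> t $ i - \<zeta> t $ i) has_vector_derivative
          (horizontal X u (\<gamma> t) $ i - horizontal X u (\<zeta> t) $ i)) (at t within {0..1})"
        using assms(1,2) that unfolding integral_curve_def
        by (intro has_vector_derivative_diff bounded_linear.has_vector_derivative[OF bounded_linear_vec_nth]) auto
      ultimately show ?thesis by simp
    qed
    then obtain c where "\<And>t. t \<in> {0..1} \<Longrightarrow> \<gamma> t $ i - \<zeta> t $ i = c"
      using has_vector_derivative_zero_constant[of "{0..1}" "\<lambda>t. \<gamma> t $ i - \<zeta> t $ i"] by auto
    from this[of 0] this show ?case using assms(3) by auto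
  qed
  then show ?thesis using assms(4) by (auto simp: vec_eq_iff)
qed

text \<open>
  This is the Picard iteration for the field \<open>u \<cdot> X\<close> started at \<open>0\<close> and evaluated at time \<open>1\<close>.  The value at
  time \<open>t\<close> is the one for \<open>t u\<close> at time \<open>1\<close>, so that no separate time variable is needed and continuity in
  \<open>u\<close> follows from that of a parametric integral over a fixed interval.
\<close>

primrec picard :: "nat \<Rightarrow> real^'m \<Rightarrow> real^'n" where
  "picard 0 u = 0"
| "picard (Suc k) u = integral {0..1} (\<lambda>\<sigma>. horizontal X u (picard k (\<sigma> *\<^sub>R u)))"

lemma continuous_picard: "continuous_on S (picard k)"
proof -
  have "continuous_on UNIV (picard k)"
  proof (induction k)
    case (Suc k)
    have "continuous_on (UNIV \<times> cbox 0 1) (\<lambda>(u, \<sigma>::real). horizontal X u (picard k (\<sigma> *\<^sub>R u)))"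
      unfolding split_beta
      by (rule continuous_on_compose2[OF continuous_horizontal, unfolded split_beta,
            where f = "\<lambda>p. (fst p, picard k (snd p *\<^sub>R fst p))", simplified fst_conv snd_conv])
         (auto intro!: continuous_intros continuous_on_compose2[OF Suc])
    from integral_continuous_on_param[OF this] show ?case by (simp add: fun_eq_iff)
  qed simp
  then show ?thesis using continuous_on_subset by blast
qed

lemma continuous_picard_integrand:
  "continuous_on S (\<lambda>\<tau>::real. horizontal X u (picard k (\<tau> *\<^sub>R u)))"
  by (rule continuous_on_compose2[OF continuous_horizontal, unfolded split_beta,
        where f = "\<lambda>\<tau>. (u, picard k (\<tau> *\<^sub>R u))", simplified fst_conv snd_conv])
     (auto intro!: continuous_intros continuous_on_compose2[OF continuous_picard[of UNIV]])

lemma picard_Suc_ray: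
  assumes "0 \<le> t" "t \<le> 1"
  shows "picard (Suc k) (t *\<^sub>R u) = integral {0..t} (\<lambda>\<tau>. horizontal X u (picard k (\<tau> *\<^sub>R u)))"
proof -
  define f where "f \<tau> = horizontal X u (picard k (\<tau> *\<^sub>R u))" for \<tau> :: real
  define F where "F r = integral {0..r} f" for r
  have F: "(F has_vector_derivative f r) (at r within {0..1})" if "r \<in> {0..1}" for r
    unfolding F_def f_def using that
    by (intro integral_has_vector_derivative continuous_picard_integrand)
  have "((F \<circ> (\<lambda>\<sigma>. t * \<sigma>)) has_vector_derivative t *\<^sub>R f (t * \<sigma>)) (at \<sigma> within {0..1})"
    if "\<sigma> \<in> {0..1}" for \<sigma>
  proof (rule vector_diff_chain_within)
    have sub: "(\<lambda>\<sigma>. t * \<sigma>) ` {0..1} \<subseteq> {0..1}"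
      using assms by (auto intro: mult_le_one)
    with that have "t * \<sigma> \<in> {0..1}" by blast
    from has_vector_derivative_within_subset[OF F[OF this] sub]
    show "(F has_vector_derivative f (t * \<sigma>)) (at (t * \<sigma>) within (\<lambda>\<sigma>. t * \<sigma>) ` {0..1})" .
  qed (auto intro!: derivative_eq_intros)
  from fundamental_theorem_of_calculus[OF _ this]
  have "((\<lambda>\<sigma>. t *\<^sub>R f (t * \<sigma>)) has_integral F t) {0..1}"
    by (simp add: F_def)
  then have "integral {0..1} (\<lambda>\<sigma>. t *\<^sub>R f (t * \<sigma>)) = F t"
    by (rule integral_unique)
  then show ?thesis
    by (simp add: F_def f_def[abs_def] horizontal_scale mult.commute)
qed

text \<open>
  The components of weight at most \<open>k\<close> no longer change after \<open>k\<close> iterations, since by triangularity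
  each is obtained by integrating functions of components of smaller weight.
\<close>

lemma picard_stable:
  "wt i \<le> k \<Longrightarrow> picard (Suc k) u $ i = picard k u $ i"
proof (induction k arbitrary: i u)
  case 0
  then show ?case using wt_pos[of i] by simp
next
  case (Suc k)
  have int: "(\<lambda>\<sigma>. horizontal X u (picard k (\<sigma> *\<^sub>R u))) integrable_on {0..1::real}" for k
    by (rule integrable_continuous_real[OF continuous_picard_integrand])
  have "horizontal X u (picard (Suc k) (\<sigma> *\<^sub>R u)) $ i = horizontal X u (picard k (\<sigma> *\<^sub>R u)) $ i"
    for \<sigma> :: real
    by (rule horizontal_triangular) (use Suc in \<open>auto simp del: picard.simps\<close>)
  then show ?case
    using integral_component_eq_cart[OF int[of "Suc k"], of i] integral_component_eq_cart[OF int[of k], of i]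
    by simp
qed

lemma picard_fixed: "picard (Suc s) u = picard s u"
  using picard_stable[OF wt_le] by (simp add: vec_eq_iff del: picard.simps)

lemma picard_0: "picard k 0 = 0"
  by (cases k) (simp_all add: horizontal_zero)

lemma picard_integral_curve: "integral_curve u (\<lambda>t. picard s (t *\<^sub>R u))"
  unfolding integral_curve_def
proof
  fix t :: real assume t: "t \<in> {0..1}"
  have "((\<lambda>t. integral {0..t} (\<lambda>\<tau>. horizontal X u (picard s (\<tau> *\<^sub>R u)))) has_vector_derivative
      horizontal X u (picard s (t *\<^sub>R u))) (at t within {0..1})"
    by (rule integral_has_vector_derivative[OF continuous_picard_integrand t])
  then show "((\<lambda>t. picard s (t *\<^sub>R u)) has_vector_derivative horizontal X u (picard s (t *\<^sub>R u)))
      (at t within {0..1})"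
    by (rule has_vector_derivative_transform[OF t, rotated])
       (simp add: picard_Suc_ray flip: picard_fixed del: picard.simps)
qed

abbreviation Exp :: "real^'m \<Rightarrow> real^'n" where "Exp u \<equiv> lie_exp (horizontal X u)"

lemma Exp_eqI:
  assumes "integral_curve u \<gamma>" "\<gamma> 0 = 0"
  shows "Exp u = \<gamma> 1"
  unfolding lie_exp_def
proof (rule the_equality)
  show "\<exists>\<zeta>. \<zeta> 0 = 0 \<and> (\<forall>t\<in>{0..1}. (\<zeta> has_vector_derivative horizontal X u (\<zeta> t)) (at t within {0..1}))
      \<and> \<zeta> 1 = \<gamma> 1"
    using assms unfolding integral_curve_def by blast
next
  fix y
  assume "\<exists>\<zeta>. \<zeta> 0 = 0 \<and> (\<forall>t\<in>{0..1}. (\<zeta> has_vector_derivative horizontal X u (\<zeta> t)) (at t within {0..1}))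
      \<and> \<zeta> 1 = y"
  then obtain \<zeta> where "\<zeta> 0 = 0" "integral_curve u \<zeta>" "\<zeta> 1 = y" unfolding integral_curve_def by blast
  then show "y = \<gamma> 1" using integral_curve_unique[OF assms(1), of \<zeta> 1] assms(2) by simp
qed

lemma Exp_eq_picard: "Exp u = picard s u"
  using Exp_eqI[OF picard_integral_curve] by (simp add: picard_0)

lemma Exp_0: "Exp 0 = 0"
  by (simp add: Exp_eq_picard picard_0)

lemma continuous_Exp: "continuous_on S Exp"
  by (simp add: Exp_eq_picard[abs_def] continuous_picard)

lemma Exp_integral_curve: "integral_curve u (\<lambda>t. Exp (t *\<^sub>R u))"
  by (simp add: Exp_eq_picard picard_integral_curve)

text \<open>
  A left translation followed by a dilation multiplies the control of every horizontal curve by \<open>r\<close>.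
  This carries integral curves to integral curves, and it makes the distance left-invariant
  and homogeneous.
\<close>

lemma similarity_derivative:
  assumes "r > 0"
  obtains T where "\<And>z. ((\<lambda>z. \<delta> r (c \<cdot> z)) has_derivative T z) (at z)"
    "\<And>v. continuous_on UNIV (\<lambda>z. T z v)"
    "\<And>u z. T z (horizontal X u z) = horizontal X (r *\<^sub>R u) (\<delta> r (c \<cdot> z))"
proof -
  obtain T where T: "\<And>z. ((\<lambda>z. c \<cdot> z) has_derivative T z) (at z)"
    "\<And>v. continuous_on UNIV (\<lambda>z. T z v)"
    "\<And>u z. T z (horizontal X u z) = horizontal X u (c \<cdot> z)"
    using left_translation_derivative[of c] by blast
  show ?thesis
  proof (rule that[of "\<lambda>z v. \<delta> r (T z v)"])
    show "((\<lambda>z. \<delta> r (c \<cdot> z)) has_derivative (\<lambda>v. \<delta> r (T z v))) (at z)" for z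
      by (rule has_derivative_compose[OF T(1) dilation_has_derivative])
    show "continuous_on UNIV (\<lambda>z. \<delta> r (T z v))" for v
      by (rule continuous_on_compose2[OF continuous_on_dilation[of UNIV] T(2)]) simp
    show "\<delta> r (T z (horizontal X u z)) = horizontal X (r *\<^sub>R u) (\<delta> r (c \<cdot> z))" for u z
      by (simp add: T(3) dilation_horizontal[OF assms])
  qed
qed

lemma similarity_curve_derivative:
  assumes "r > 0" and der: "(\<gamma> has_vector_derivative horizontal X u (\<gamma> t)) (at t within S)"
  shows "((\<lambda>t. \<delta> r (c \<cdot> \<gamma> t)) has_vector_derivative horizontal X (r *\<^sub>R u) (\<delta> r (c \<cdot> \<gamma> t))) (at t within S)"
proof -
  obtain T where T: "\<And>z. ((\<lambda>z. \<delta> r (c \<cdot> z)) has_derivative T z) (at z)"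
    "\<And>u z. T z (horizontal X u z) = horizontal X (r *\<^sub>R u) (\<delta> r (c \<cdot> z))"
    using similarity_derivative[OF assms(1), of c] by metis
  show ?thesis
    using vector_derivative_diff_chain_within[OF der has_derivative_at_withinI[OF T(1)]]
    by (simp add: o_def T(2))
qed

lemma similarity_integral_curve:
  "r > 0 \<Longrightarrow> integral_curve u \<gamma> \<Longrightarrow> integral_curve (r *\<^sub>R u) (\<lambda>t. \<delta> r (c \<cdot> \<gamma> t))"
  unfolding integral_curve_def by (blast intro: similarity_curve_derivative)

lemma dilation_Exp: "r > 0 \<Longrightarrow> \<delta> r (Exp u) = Exp (r *\<^sub>R u)"
  using Exp_eqI[OF similarity_integral_curve[OF _ Exp_integral_curve], of r 0 u] by (simp add: Exp_0)

text \<open>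
  As \<open>t\<close> runs over \<open>[0, 1]\<close>, both \<open>E ((a + t b) u)\<close> and \<open>E (a u) \<cdot> E (t b u)\<close> are integral curves of
  \<open>b u \<cdot> X\<close> that start at \<open>E (a u)\<close>.
\<close>

lemma Exp_add:
  assumes "a \<ge> 0" "b \<ge> 0"
  shows "Exp ((a + b) *\<^sub>R u) = Exp (a *\<^sub>R u) \<cdot> Exp (b *\<^sub>R u)"
proof (cases "a + b = 0")
  case True
  then show ?thesis using assms by (simp add: Exp_0 add_nonneg_eq_0_iff)
next
  case False
  \<comment> \<open>The curve of \<open>c u\<close> on \<open>[0, 1]\<close> reaches \<open>E ((a + b) u)\<close>; its part after time \<open>a / c\<close> is needed.\<close>
  define c where "c = a + b"
  have c: "c > 0" using False assms by (simp add: c_def)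
  have sub: "(\<lambda>t. (a + t * b) / c) ` {0..1} \<subseteq> {0..1}"
    using assms c by (auto simp: divide_simps c_def intro: mult_left_le_one_le)
  have "integral_curve (b *\<^sub>R u) (\<lambda>t. Exp (((a + t * b) / c) *\<^sub>R c *\<^sub>R u))"
    unfolding integral_curve_def
  proof
    fix t :: real assume t: "t \<in> {0..1}"
    have "(((\<lambda>t. Exp (t *\<^sub>R c *\<^sub>R u)) \<circ> (\<lambda>t. (a + t * b) / c)) has_vector_derivative
      (b / c) *\<^sub>R horizontal X (c *\<^sub>R u) (Exp (((a + t * b) / c) *\<^sub>R c *\<^sub>R u))) (at t within {0..1})"
    proof (rule vector_diff_chain_within)
      show "((\<lambda>t. (a + t * b) / c) has_vector_derivative b / c) (at t within {0..1})"
        by (auto intro!: derivative_eq_intros)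
      show "((\<lambda>t. Exp (t *\<^sub>R c *\<^sub>R u)) has_vector_derivative
          horizontal X (c *\<^sub>R u) (Exp (((a + t * b) / c) *\<^sub>R c *\<^sub>R u)))
          (at ((a + t * b) / c) within (\<lambda>t. (a + t * b) / c) ` {0..1})"
        by (rule has_vector_derivative_within_subset
              [OF bspec[OF Exp_integral_curve[unfolded integral_curve_def]] sub]) (use sub t in blast)
    qed
    then show "((\<lambda>t. Exp (((a + t * b) / c) *\<^sub>R c *\<^sub>R u)) has_vector_derivative
        horizontal X (b *\<^sub>R u) (Exp (((a + t * b) / c) *\<^sub>R c *\<^sub>R u))) (at t within {0..1})"
      using c by (simp add: o_def horizontal_scale)
  qed
  moreover have "integral_curve (b *\<^sub>R u) (\<lambda>t. Exp (a *\<^sub>R u) \<cdot> Exp (t *\<^sub>R b *\<^sub>R u))"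
    using similarity_integral_curve[OF zero_less_one Exp_integral_curve, of "b *\<^sub>R u" "Exp (a *\<^sub>R u)"] by simp
  ultimately have "Exp (((a + 1 * b) / c) *\<^sub>R c *\<^sub>R u) = Exp (a *\<^sub>R u) \<cdot> Exp (1 *\<^sub>R b *\<^sub>R u)"
    by (rule integral_curve_unique) (use c in \<open>simp_all add: Exp_0\<close>)
  then show ?thesis using c by (simp add: c_def)
qed

lemma dilation_multiexp:
  "r > 0 \<Longrightarrow> \<delta> r (multiexp G X us) = multiexp G X (map (\<lambda>u. r *\<^sub>R u) us)"
  by (induction us) (simp_all add: multiexp_def dilation_mult dilation_Exp one_eq_zero)

lemma multiexp_replicate:
  "multiexp G X (replicate q u) = Exp (real q *\<^sub>R u)"
proof (induction q)
  case (Suc q)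
  have "multiexp G X (replicate (Suc q) u) = Exp (1 *\<^sub>R u) \<cdot> Exp (real q *\<^sub>R u)"
    using Suc by (simp add: multiexp_def)
  then show ?case using Exp_add[of 1 "real q" u] by simp
qed (simp add: multiexp_def one_eq_zero Exp_0)


section \<open>The subRiemannian distance near the identity\<close>

lemma horizontal_path_similarity:
  assumes r: "r > 0" and path: "horizontal_path X a b \<gamma> u"
  shows "horizontal_path X a b (\<lambda>t. \<delta> r (c \<cdot> \<gamma> t)) (\<lambda>t. r *\<^sub>R u t)"
proof -
  have "a < b" using path by (simp add: horizontal_path_def)
  obtain L where L: "L-lipschitz_on {a..b} \<gamma>" using path by (auto simp: horizontal_path_def)
  obtain T where T: "\<And>z. ((\<lambda>z. \<delta> r (c \<cdot> z)) has_derivative T z) (at z)"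
    "\<And>v. continuous_on UNIV (\<lambda>z. T z v)"
    using similarity_derivative[OF r, of c] by metis
  have "bounded (\<gamma> ` {a..b})"
    using lipschitz_on_continuous_on[OF L]
    by (intro compact_imp_bounded compact_continuous_image) auto
  then obtain R where "\<gamma> ` {a..b} \<subseteq> cball 0 R"
    unfolding bounded_iff image_subset_iff mem_cball_0 by blast
  moreover obtain K where "K-lipschitz_on (cball 0 R) (\<lambda>z. \<delta> r (c \<cdot> z))"
    using C1_lipschitz_on_cball[OF T] by blast
  ultimately have "(K * L)-lipschitz_on {a..b} (\<lambda>t. \<delta> r (c \<cdot> \<gamma> t))"
    by (intro lipschitz_on_compose2[OF L]) (auto intro: lipschitz_on_subset)
  moreover have "AE t in lebesgue. t \<in> {a<..<b} \<longrightarrow>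
      ((\<lambda>t. \<delta> r (c \<cdot> \<gamma> t)) has_vector_derivative horizontal X (r *\<^sub>R u t) (\<delta> r (c \<cdot> \<gamma> t))) (at t)"
  proof (rule AE_mp)
    show "AE t in lebesgue. t \<in> {a<..<b} \<longrightarrow>
        (\<gamma> has_vector_derivative horizontal X (u t) (\<gamma> t)) (at t)"
      using path by (simp add: horizontal_path_def)
  qed (auto intro!: AE_I2 similarity_curve_derivative[OF r])
  moreover have "set_integrable lebesgue {a<..<b} (\<lambda>t. r *\<^sub>R u t)"
    using path by (intro set_integrable_scaleR_right) (simp add: horizontal_path_def)
  ultimately show ?thesis
    unfolding horizontal_path_def using \<open>a < b\<close> by blast
qed

lemma horizontal_bound_on_cball:
  obtains M where "M > 0" "\<And>v x. norm x \<le> R \<Longrightarrow> norm (horizontal X v x) \<le> M * norm v"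
proof -
  have "continuous_on (cball 0 R) (\<lambda>x. \<Sum>j\<in>UNIV. norm (X j x))"
    by (intro continuous_intros continuous_on_subset[OF continuous_X]) auto
  then have "bounded ((\<lambda>x. \<Sum>j\<in>UNIV. norm (X j x)) ` cball 0 R)"
    by (intro compact_imp_bounded compact_continuous_image) auto
  then obtain B where B: "\<And>x. x \<in> cball 0 R \<Longrightarrow> \<bar>\<Sum>j\<in>UNIV. norm (X j x)\<bar> \<le> B"
    unfolding bounded_iff by (metis image_eqI real_norm_def)
  show ?thesis
  proof (rule that[of "max B 1"])
    fix v :: "real^'m" and x :: "real^'n" assume "norm x \<le> R"
    have "norm (horizontal X v x) \<le> (\<Sum>j\<in>UNIV. norm v * norm (X j x))"
      unfolding horizontal_def
      by (intro sum_norm_le) (auto intro!: mult_right_mono component_le_norm_cart)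
    also have "\<dots> = (\<Sum>j\<in>UNIV. norm (X j x)) * norm v"
      by (simp add: sum_distrib_left mult.commute)
    also have "\<dots> \<le> max B 1 * norm v"
      using B[of x] \<open>norm x \<le> R\<close> by (intro mult_right_mono) auto
    finally show "norm (horizontal X v x) \<le> max B 1 * norm v" .
  qed simp
qed

text \<open>
  The field \<open>v \<cdot> X\<close> has norm at most \<open>M |v|\<close> on the ball of radius \<open>\<kappa>\<close>.  Up to the first time at which a
  path reaches the boundary of this ball it has moved at most \<open>M\<close> times its length, so a path shorter than
  \<open>\<kappa> / M\<close> never gets there.
\<close>

lemma short_path_from_0_ends_near_0:
  assumes "\<kappa> > 0"
  shows "\<exists>\<eta>>0. \<forall>a b \<gamma> u. horizontal_path X a b \<gamma> u \<longrightarrow> \<gamma> a = 0 \<longrightarrow>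
    set_lebesgue_integral lebesgue {a<..<b} (\<lambda>t. norm (u t)) < \<eta> \<longrightarrow> norm (\<gamma> b) < \<kappa>"
proof -
  obtain M where M: "M > 0" "\<And>v x. norm x \<le> \<kappa> \<Longrightarrow> norm (horizontal X v x) \<le> M * norm v"
    using horizontal_bound_on_cball[of \<kappa>] by blast
  have "norm (\<gamma> b) < \<kappa>"
    if path: "horizontal_path X a b \<gamma> u" and "\<gamma> a = 0"
      and len: "set_lebesgue_integral lebesgue {a<..<b} (\<lambda>t. norm (u t)) < \<kappa> / M" for a b \<gamma> u
  proof (rule ccontr)
    assume "\<not> norm (\<gamma> b) < \<kappa>"
    have "a < b" using path by (simp add: horizontal_path_def)
    obtain L where L: "L-lipschitz_on {a..b} \<gamma>" using path by (auto simp: horizontal_path_def)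
    define S where "S = {t\<in>{a..b}. \<kappa> \<le> norm (\<gamma> t)}"
    have "compact S"
      unfolding S_def compact_eq_bounded_closed
    proof
      show "bounded {t\<in>{a..b}. \<kappa> \<le> norm (\<gamma> t)}"
        by (rule bounded_subset[OF bounded_closed_interval[of a b]]) auto
      show "closed {t\<in>{a..b}. \<kappa> \<le> norm (\<gamma> t)}"
        by (intro continuous_on_closed_Collect_le continuous_intros lipschitz_on_continuous_on[OF L])
    qed
    moreover have "b \<in> S" using \<open>\<not> norm (\<gamma> b) < \<kappa>\<close> \<open>a < b\<close> by (simp add: S_def)
    ultimately obtain e where e: "e \<in> S" "\<And>t. t \<in> S \<Longrightarrow> e \<le> t"
      using compact_attains_inf[of S] by blast
    have "a \<le> e" "e \<le> b" "\<kappa> \<le> norm (\<gamma> e)" using e(1) by (auto simp: S_def)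
    have before: "norm (\<gamma> t) < \<kappa>" if "t \<in> {a<..<e}" for t
      using e(2)[of t] that \<open>e \<le> b\<close> by (force simp: S_def)
    have "AE t in lebesgue. t \<in> {a<..<b} \<longrightarrow>
        (\<gamma> has_vector_derivative horizontal X (u t) (\<gamma> t)) (at t)"
      using path by (simp add: horizontal_path_def)
    then obtain N where N: "N \<in> null_sets lebesgue"
      "\<And>t. t \<in> {a<..<b} - N \<Longrightarrow> (\<gamma> has_vector_derivative horizontal X (u t) (\<gamma> t)) (at t)"
      unfolding eventually_ae_filter by auto
    have "set_integrable lebesgue {a<..<b} (\<lambda>t. norm (u t))"
      using path by (intro set_integrable_norm) (simp add: horizontal_path_def)
    then have int: "(\<lambda>t. norm (u t)) integrable_on {a..b}"
      and len': "integral {a..b} (\<lambda>t. norm (u t)) < \<kappa> / M"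
      using len set_lebesgue_integral_eq_integral[of "{a<..<b}" "\<lambda>t. norm (u t)"]
      by (simp_all add: integrable_on_open_interval_real integral_open_interval_real)
    have int_e: "(\<lambda>t. norm (u t)) integrable_on {a..e}"
      by (rule integrable_on_subinterval[OF int]) (use \<open>e \<le> b\<close> in auto)
    have "norm (\<gamma> e - \<gamma> a) \<le> integral {a..e} (\<lambda>t. M * norm (u t))"
    proof (rule lipschitz_curve_norm_bound[where D = "\<lambda>t. horizontal X (u t) (\<gamma> t)" and N = N])
      show "L-lipschitz_on {a..e} \<gamma>" by (rule lipschitz_on_subset[OF L]) (use \<open>e \<le> b\<close> in auto)
      show "negligible N" using N(1) by (simp add: negligible_iff_null_sets)
      show "(\<gamma> has_vector_derivative horizontal X (u t) (\<gamma> t)) (at t)" if "t \<in> {a<..<e} - N" for t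
        using N(2)[of t] that \<open>e \<le> b\<close> by auto
      show "norm (horizontal X (u t) (\<gamma> t)) \<le> M * norm (u t)" if "t \<in> {a<..<e} - N" for t
        using M(2) before[of t] that by auto
      show "(\<lambda>t. M * norm (u t)) integrable_on {a..e}"
        using int_e by (rule integrable_on_mult_right)
    qed (use \<open>a \<le> e\<close> M(1) in auto)
    also have "\<dots> = M * integral {a..e} (\<lambda>t. norm (u t))" by simp
    also have "\<dots> \<le> M * integral {a..b} (\<lambda>t. norm (u t))"
      using M(1) \<open>e \<le> b\<close> by (intro mult_left_mono integral_subset_le int int_e) auto
    also have "\<dots> < \<kappa>" using len' M(1) by (simp add: field_simps)
    finally show False using \<open>\<kappa> \<le> norm (\<gamma> e)\<close> \<open>\<gamma> a = 0\<close> by simp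
  qed
  then show ?thesis using M(1) assms by (intro exI[of _ "\<kappa> / M"]) auto
qed

text \<open>
  The map \<open>z \<mapsto> \<delta> r (c\<^sup>-\<^sup>1 \<cdot> z)\<close> sends a path from \<open>c\<close> to \<open>y\<close> to a path from \<open>0\<close> that is
  \<open>r\<close> times as long.
\<close>

lemma sr_dist_small_imp_norm_small:
  assumes "\<kappa> > 0"
  shows "\<exists>\<eta>>0. \<forall>r>0. \<forall>c y. sr_dist X c y < ennreal (\<eta> / r) \<longrightarrow> norm (\<delta> r (inv\<^bsub>G\<^esub> c \<cdot> y)) < \<kappa>"
proof -
  obtain \<eta> where \<eta>: "\<eta> > 0" and short: "\<And>a b \<gamma> u. horizontal_path X a b \<gamma> u \<Longrightarrow> \<gamma> a = 0 \<Longrightarrow>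
    set_lebesgue_integral lebesgue {a<..<b} (\<lambda>t. norm (u t)) < \<eta> \<Longrightarrow> norm (\<gamma> b) < \<kappa>"
    using short_path_from_0_ends_near_0[OF assms] by blast
  have "norm (\<delta> r (inv\<^bsub>G\<^esub> c \<cdot> y)) < \<kappa>" if r: "r > 0" and d: "sr_dist X c y < ennreal (\<eta> / r)" for r c y
  proof -
    obtain a b \<gamma> u where path: "horizontal_path X a b \<gamma> u" and ends: "\<gamma> a = c" "\<gamma> b = y"
      and "ennreal (set_lebesgue_integral lebesgue {a<..<b} (\<lambda>t. norm (u t))) < ennreal (\<eta> / r)"
      using d unfolding sr_dist_def Inf_less_iff by blast
    moreover have "0 \<le> set_lebesgue_integral lebesgue {a<..<b} (\<lambda>t. norm (u t))"
      unfolding set_lebesgue_integral_def by (intro integral_nonneg_AE) auto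
    ultimately have "set_lebesgue_integral lebesgue {a<..<b} (\<lambda>t. norm (u t)) < \<eta> / r"
      by (simp add: ennreal_less_iff)
    then have "set_lebesgue_integral lebesgue {a<..<b} (\<lambda>t. norm (r *\<^sub>R u t)) < \<eta>"
      using r by (simp add: field_simps)
    from short[OF horizontal_path_similarity[OF r path] _ this, of "inv\<^bsub>G\<^esub> c"]
    show ?thesis by (simp add: ends)
  qed
  with \<eta> show ?thesis by blast
qed

section \<open>Broken horizontal lines in horizontally convex sets\<close>

text \<open>
  Uniform continuity of \<open>(y, u, \<tau>) \<mapsto> y \<cdot> E (\<tau> u)\<close> on a compact set; the uniformity in \<open>\<sigma>\<close> and \<open>\<tau>\<close> is
  what later makes the size of the neighbourhoods independent of \<open>t\<close>.
\<close>

lemma uniform_step: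
  assumes "\<eta> > 0"
  shows "\<exists>\<epsilon>>0. \<forall>\<sigma>\<in>{0..1}. \<forall>\<tau>\<in>{0..1}. \<forall>y u. dist y (z \<cdot> Exp (\<sigma> *\<^sub>R \<xi>)) < \<epsilon> \<longrightarrow> dist u \<xi> < \<epsilon> \<longrightarrow>
     dist (y \<cdot> Exp (\<tau> *\<^sub>R u)) (z \<cdot> Exp (\<sigma> *\<^sub>R \<xi>) \<cdot> Exp (\<tau> *\<^sub>R \<xi>)) < \<eta>"
proof -
  have "compact ((\<lambda>\<sigma>::real. z \<cdot> Exp (\<sigma> *\<^sub>R \<xi>)) ` {0..1})"
    by (intro compact_continuous_image continuous_on_mult'
          continuous_on_compose2[OF continuous_Exp[of UNIV]] continuous_intros) auto
  from compact_imp_bounded[OF this] obtain R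
    where R: "\<And>\<sigma>. \<sigma> \<in> {0..1} \<Longrightarrow> norm (z \<cdot> Exp (\<sigma> *\<^sub>R \<xi>)) \<le> R"
    unfolding bounded_iff by blast
  define C where "C = cball (0 :: real^'n) (R + 1) \<times> cball \<xi> 1 \<times> {0..1::real}"
  define f where "f = (\<lambda>(y, u, \<tau>::real). y \<cdot> Exp (\<tau> *\<^sub>R u))"
  have "continuous_on C f"
    unfolding f_def split_beta
    by (intro continuous_on_mult' continuous_on_compose2[OF continuous_Exp[of UNIV]] continuous_intros) auto
  moreover have "compact C" unfolding C_def by (intro compact_Times compact_cball compact_Icc)
  ultimately have "uniformly_continuous_on C f" by (rule compact_uniformly_continuous)
  then obtain d where d: "d > 0" "\<And>p q. p \<in> C \<Longrightarrow> q \<in> C \<Longrightarrow> dist q p < d \<Longrightarrow> dist (f q) (f p) < \<eta>"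
    using \<open>\<eta> > 0\<close> unfolding uniformly_continuous_on_def by metis
  have "dist (y \<cdot> Exp (\<tau> *\<^sub>R u)) (z \<cdot> Exp (\<sigma> *\<^sub>R \<xi>) \<cdot> Exp (\<tau> *\<^sub>R \<xi>)) < \<eta>"
    if "\<sigma> \<in> {0..1}" "\<tau> \<in> {0..1}" and y: "dist y (z \<cdot> Exp (\<sigma> *\<^sub>R \<xi>)) < min 1 (d / 2)"
      and u: "dist u \<xi> < min 1 (d / 2)" for \<sigma> \<tau> y u
  proof -
    let ?w = "z \<cdot> Exp (\<sigma> *\<^sub>R \<xi>)"
    have "norm y \<le> norm ?w + dist y ?w"
      using norm_triangle_ineq[of ?w "y - ?w"] by (simp add: dist_norm)
    then have "(y, u, \<tau>) \<in> C" "(?w, \<xi>, \<tau>) \<in> C"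
      using R[OF that(1)] that by (auto simp: C_def dist_commute)
    moreover have "dist (y, u, \<tau>) (?w, \<xi>, \<tau>) < d"
    proof -
      have "dist (y, u, \<tau>) (?w, \<xi>, \<tau>) \<le> dist y ?w + dist u \<xi>"
        using sqrt_sum_squares_le_sum[of "dist y ?w" "dist u \<xi>"] by (simp add: dist_Pair_Pair)
      then show ?thesis using y u by simp
    qed
    ultimately show ?thesis using d(2) by (auto simp: f_def)
  qed
  then show ?thesis using d(1) by (intro exI[of _ "min 1 (d / 2)"]) auto
qed

text \<open>
  The bound \<open>\<eta>\<close> on the distance after the step is arbitrary, so that steps can be chained.
\<close>

lemma step_stays_in_A:
  assumes "horizontally_convex G X A" "z \<cdot> Exp \<xi> \<in> interior A" "\<eta> > 0"
  shows "\<exists>\<epsilon>>0. \<forall>\<sigma>\<ge>0. \<forall>\<tau>\<ge>0. \<forall>y\<in>A. \<forall>u. \<sigma> + \<tau> \<le> 1 \<longrightarrow>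
    dist y (z \<cdot> Exp (\<sigma> *\<^sub>R \<xi>)) < \<epsilon> \<longrightarrow> dist u \<xi> < \<epsilon> \<longrightarrow>
    y \<cdot> Exp (\<tau> *\<^sub>R u) \<in> A \<and> dist (y \<cdot> Exp (\<tau> *\<^sub>R u)) (z \<cdot> Exp ((\<sigma> + \<tau>) *\<^sub>R \<xi>)) < \<eta>"
proof -
  obtain \<rho> where \<rho>: "\<rho> > 0" "ball (z \<cdot> Exp \<xi>) \<rho> \<subseteq> A"
    using assms(2) by (auto simp: mem_interior)
  then have "min \<eta> \<rho> > 0" using assms(3) by simp
  from uniform_step[OF this] obtain \<epsilon> where \<epsilon>: "\<epsilon> > 0" and
    step: "\<And>\<sigma> \<tau> y u. \<sigma> \<in> {0..1} \<Longrightarrow> \<tau> \<in> {0..1} \<Longrightarrow> dist y (z \<cdot> Exp (\<sigma> *\<^sub>R \<xi>)) < \<epsilon> \<Longrightarrow> dist u \<xi> < \<epsilon> \<Longrightarrow>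
     dist (y \<cdot> Exp (\<tau> *\<^sub>R u)) (z \<cdot> Exp (\<sigma> *\<^sub>R \<xi>) \<cdot> Exp (\<tau> *\<^sub>R \<xi>)) < min \<eta> \<rho>"
    by blast
  have "y \<cdot> Exp (\<tau> *\<^sub>R u) \<in> A \<and> dist (y \<cdot> Exp (\<tau> *\<^sub>R u)) (z \<cdot> Exp ((\<sigma> + \<tau>) *\<^sub>R \<xi>)) < \<eta>"
    if "\<sigma> \<ge> 0" "\<tau> \<ge> 0" "\<sigma> + \<tau> \<le> 1" "y \<in> A"
      and near: "dist y (z \<cdot> Exp (\<sigma> *\<^sub>R \<xi>)) < \<epsilon>" "dist u \<xi> < \<epsilon>" for \<sigma> \<tau> y u
  proof
    show "dist (y \<cdot> Exp (\<tau> *\<^sub>R u)) (z \<cdot> Exp ((\<sigma> + \<tau>) *\<^sub>R \<xi>)) < \<eta>"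
      using step[OF _ _ near, of \<tau>] that(1-3) by (simp add: Exp_add G_assoc)
    \<comment> \<open>Prolonged to time \<open>1 - \<sigma>\<close>, the segment ends in the ball around \<open>z \<cdot> E \<xi>\<close>, inside \<open>A\<close>.\<close>
    have "dist (y \<cdot> Exp ((1 - \<sigma>) *\<^sub>R u)) (z \<cdot> Exp (\<sigma> *\<^sub>R \<xi>) \<cdot> Exp ((1 - \<sigma>) *\<^sub>R \<xi>)) < \<rho>"
      using step[OF _ _ near, of "1 - \<sigma>"] that(1-3) by simp
    then have "dist (y \<cdot> Exp ((1 - \<sigma>) *\<^sub>R u)) (z \<cdot> Exp \<xi>) < \<rho>"
      using Exp_add[of \<sigma> "1 - \<sigma>" \<xi>] that(1-3) by (simp add: G_assoc)
    then have "y \<cdot> Exp ((1 - \<sigma>) *\<^sub>R u) \<in> A"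
      using \<rho>(2) by (auto simp: dist_commute)
    moreover have line: "horizontal_line G y (horizontal X u) t = y \<cdot> Exp (t *\<^sub>R u)" for t
      by (simp add: horizontal_line_def horizontal_scale)
    ultimately have "horizontal_line G y (horizontal X u) 0 \<in> A"
      "horizontal_line G y (horizontal X u) (1 - \<sigma>) \<in> A"
      using \<open>y \<in> A\<close> by (simp_all add: Exp_0)
    then have "horizontal_line G y (horizontal X u) ` {0..1 - \<sigma>} \<subseteq> A"
      using assms(1) unfolding horizontally_convex_def by blast
    then have "horizontal_line G y (horizontal X u) \<tau> \<in> A"
      using that(1-3) by auto
    then show "y \<cdot> Exp (\<tau> *\<^sub>R u) \<in> A" by (simp add: line)
  qed
  with \<epsilon> show ?thesis by blast
qed

text \<open>
  Induction on the number of steps, for all starting times \<open>\<sigma>\<close> at once: one step moves the reference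
  point from \<open>z \<cdot> E (\<sigma> \<xi>)\<close> to \<open>z \<cdot> E ((\<sigma> + \<tau>) \<xi>)\<close>, and the tolerance of the remaining steps fixes
  that of the first.
\<close>

lemma multiexp_stays_in_A:
  assumes "horizontally_convex G X A" "z \<cdot> Exp \<xi> \<in> interior A"
  shows "\<exists>\<epsilon>>0. \<forall>\<sigma>\<ge>0. \<forall>\<tau>\<ge>0. \<forall>y\<in>A. \<forall>us. length us = q \<longrightarrow> \<sigma> + real q * \<tau> \<le> 1 \<longrightarrow>
    dist y (z \<cdot> Exp (\<sigma> *\<^sub>R \<xi>)) < \<epsilon> \<longrightarrow> (\<forall>u\<in>set us. dist u \<xi> < \<epsilon>) \<longrightarrow>
    y \<cdot> multiexp G X (map (\<lambda>u. \<tau> *\<^sub>R u) us) \<in> A"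
proof (induction q)
  case 0
  show ?case by (intro exI[of _ 1]) (simp add: multiexp_def one_eq_zero)
next
  case (Suc q)
  then obtain \<epsilon> where \<epsilon>: "\<epsilon> > 0" and IH: "\<forall>\<sigma>\<ge>0. \<forall>\<tau>\<ge>0. \<forall>y\<in>A. \<forall>us. length us = q \<longrightarrow>
      \<sigma> + real q * \<tau> \<le> 1 \<longrightarrow> dist y (z \<cdot> Exp (\<sigma> *\<^sub>R \<xi>)) < \<epsilon> \<longrightarrow> (\<forall>u\<in>set us. dist u \<xi> < \<epsilon>) \<longrightarrow>
      y \<cdot> multiexp G X (map (\<lambda>u. \<tau> *\<^sub>R u) us) \<in> A"
    by auto
  obtain \<epsilon>' where \<epsilon>': "\<epsilon>' > 0" and step: "\<forall>\<sigma>\<ge>0. \<forall>\<tau>\<ge>0. \<forall>y\<in>A. \<forall>u. \<sigma> + \<tau> \<le> 1 \<longrightarrow>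
      dist y (z \<cdot> Exp (\<sigma> *\<^sub>R \<xi>)) < \<epsilon>' \<longrightarrow> dist u \<xi> < \<epsilon>' \<longrightarrow>
      y \<cdot> Exp (\<tau> *\<^sub>R u) \<in> A \<and> dist (y \<cdot> Exp (\<tau> *\<^sub>R u)) (z \<cdot> Exp ((\<sigma> + \<tau>) *\<^sub>R \<xi>)) < \<epsilon>"
    using step_stays_in_A[OF assms \<epsilon>] by auto
  show ?case
  proof (intro exI[of _ "min \<epsilon> \<epsilon>'"] conjI allI impI ballI)
    fix \<sigma> \<tau> :: real and y us
    assume *: "0 \<le> \<sigma>" "0 \<le> \<tau>" "y \<in> A" "length us = Suc q" "\<sigma> + real (Suc q) * \<tau> \<le> 1"
      "dist y (z \<cdot> Exp (\<sigma> *\<^sub>R \<xi>)) < min \<epsilon> \<epsilon>'" "\<forall>u\<in>set us. dist u \<xi> < min \<epsilon> \<epsilon>'"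
    then obtain v vs where us: "us = v # vs" "length vs = q" by (auto simp: length_Suc_conv)
    have le: "\<sigma> + \<tau> + real q * \<tau> \<le> 1" using *(5) by (simp add: algebra_simps)
    have "0 \<le> real q * \<tau>" using *(2) by simp
    then have le': "\<sigma> + \<tau> \<le> 1" using le by linarith
    have 1: "y \<cdot> Exp (\<tau> *\<^sub>R v) \<in> A \<and> dist (y \<cdot> Exp (\<tau> *\<^sub>R v)) (z \<cdot> Exp ((\<sigma> + \<tau>) *\<^sub>R \<xi>)) < \<epsilon>"
      by (rule step[rule_format]) (use * le' us in auto)
    have "y \<cdot> Exp (\<tau> *\<^sub>R v) \<cdot> multiexp G X (map (\<lambda>u. \<tau> *\<^sub>R u) vs) \<in> A"
      by (rule IH[rule_format, of "\<sigma> + \<tau>"]) (use 1 * le us in auto)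
    then show "y \<cdot> multiexp G X (map (\<lambda>u. \<tau> *\<^sub>R u) us) \<in> A"
      by (simp add: us multiexp_def G_assoc)
  qed (use \<epsilon> \<epsilon>' in auto)
qed

text \<open>
  The set of all \<open>y\<close> satisfying the last premise is \<open>x \<cdot> \<delta> (t/p) U\<close>, where \<open>U\<close> is the ball that local
  openness provides in the image of \<open>\<Gamma>\<close>.
\<close>

lemma dilated_ball_subset_A:
  assumes "horizontally_convex G X A" "z \<cdot> Exp \<xi> \<in> interior A"
    and open_map: "multiexp_locally_open_at G X (replicate p \<xi>)" and "p > 0"
  shows "\<exists>\<epsilon>>0. \<exists>\<sigma>>0. \<forall>x\<in>A. \<forall>t y. dist x z < \<epsilon> \<longrightarrow> 0 < t \<longrightarrow> t \<le> 1 \<longrightarrow>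
    \<delta> (real p / t) (inv\<^bsub>G\<^esub> x \<cdot> y) \<in> ball (Exp (real p *\<^sub>R \<xi>)) \<sigma> \<longrightarrow> y \<in> A"
proof -
  obtain \<epsilon> where \<epsilon>: "\<epsilon> > 0" and stay: "\<forall>\<sigma>\<ge>0. \<forall>\<tau>\<ge>0. \<forall>y\<in>A. \<forall>us. length us = p \<longrightarrow>
      \<sigma> + real p * \<tau> \<le> 1 \<longrightarrow> dist y (z \<cdot> Exp (\<sigma> *\<^sub>R \<xi>)) < \<epsilon> \<longrightarrow> (\<forall>u\<in>set us. dist u \<xi> < \<epsilon>) \<longrightarrow>
      y \<cdot> multiexp G X (map (\<lambda>u. \<tau> *\<^sub>R u) us) \<in> A"
    using multiexp_stays_in_A[OF assms(1,2), of p] by auto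
  obtain \<sigma> where \<sigma>: "\<sigma> > 0"
    "ball (Exp (real p *\<^sub>R \<xi>)) \<sigma> \<subseteq> multiexp G X ` list_ball (replicate p \<xi>) \<epsilon>"
    using open_map \<epsilon> unfolding multiexp_locally_open_at_def multiexp_replicate by blast
  have "y \<in> A" if "x \<in> A" "dist x z < \<epsilon>" "0 < t" "t \<le> 1"
    and y: "\<delta> (real p / t) (inv\<^bsub>G\<^esub> x \<cdot> y) \<in> ball (Exp (real p *\<^sub>R \<xi>)) \<sigma>" for x t y
  proof -
    obtain us where us: "us \<in> list_ball (replicate p \<xi>) \<epsilon>"
      "\<delta> (real p / t) (inv\<^bsub>G\<^esub> x \<cdot> y) = multiexp G X us"
      using y \<sigma>(2) by blast
    have len: "length us = p" using us(1) by (simp add: list_ball_def)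
    have near: "dist u \<xi> < \<epsilon>" if "u \<in> set us" for u
    proof -
      obtain i where i: "i < p" "u = us ! i" using \<open>u \<in> set us\<close> len by (auto simp: in_set_conv_nth)
      have "dist (replicate p \<xi> ! i) (us ! i)
          \<le> L2_set (\<lambda>i. dist (replicate p \<xi> ! i) (us ! i)) {..<p}"
        using i(1) by (intro member_le_L2_set) auto
      also have "\<dots> < \<epsilon>" using us(1) by (simp add: list_ball_def)
      finally show ?thesis using i by (simp add: dist_commute)
    qed
    have "x \<cdot> multiexp G X (map (\<lambda>u. (t / real p) *\<^sub>R u) us) \<in> A"
      by (rule stay[rule_format, of 0]) (use that(1-4) len near \<open>p > 0\<close> in \<open>auto simp: Exp_0\<close>)
    moreover have "multiexp G X (map (\<lambda>u. (t / real p) *\<^sub>R u) us) = inv\<^bsub>G\<^esub> x \<cdot> y"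
      using dilation_multiexp[of "t / real p" us] that(3) \<open>p > 0\<close>
      by (simp flip: us(2) add: dilation_dilation)
    ultimately show ?thesis by simp
  qed
  with \<epsilon> \<sigma>(1) show ?thesis by blast
qed

end

theorem theorem1p1:
  fixes G :: "(real^'n) monoid"
    and s p :: nat
    and wt :: "'n::finite \<Rightarrow> nat"
    and h :: "'m::finite \<Rightarrow> 'n"
    and X :: "'m \<Rightarrow> real^'n \<Rightarrow> real^'n"
    and \<xi> :: "real^'m"
    and V :: "real^'n \<Rightarrow> real^'n"
    and A :: "(real^'n) set"
    and xbar :: "real^'n"
  assumes "carnot_group G s wt h X"
    and "s \<ge> 2"
    and "V = horizontal X \<xi>"
    and "p > 0"
    and "multiexp_locally_open_at G X (replicate p \<xi>)"
    and "horizontally_convex G X A"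
    and "xbar \<in> closure A"
    and "xbar \<otimes>\<^bsub>G\<^esub> lie_exp V \<in> interior A"
  shows "\<exists>\<epsilon>>0. \<forall>x\<in>closure A. sr_dist X x xbar < ennreal \<epsilon> \<longrightarrow>
           (\<Union>t\<in>{0<..<1}. sr_ball X (x \<otimes>\<^bsub>G\<^esub> lie_exp (\<lambda>z. t *\<^sub>R V z)) (\<epsilon> * t)) \<subseteq> interior A"
proof -
  interpret carnot_group G s wt h X by fact
  let ?c = "Exp (real p *\<^sub>R \<xi>)"
  obtain \<epsilon>\<^sub>1 \<sigma> where \<epsilon>\<^sub>1: "\<epsilon>\<^sub>1 > 0" and \<sigma>: "\<sigma> > 0" and inA: "\<And>x t y. x \<in> A \<Longrightarrow> dist x xbar < \<epsilon>\<^sub>1 \<Longrightarrow>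
      0 < t \<Longrightarrow> t \<le> 1 \<Longrightarrow> \<delta> (real p / t) (inv\<^bsub>G\<^esub> x \<cdot> y) \<in> ball ?c \<sigma> \<Longrightarrow> y \<in> A"
    using dilated_ball_subset_A[of A xbar \<xi> p] assms by blast
  obtain \<kappa>\<^sub>1 where \<kappa>\<^sub>1: "\<kappa>\<^sub>1 > 0" "\<And>w. norm w < \<kappa>\<^sub>1 \<Longrightarrow> ?c \<cdot> w \<in> ball ?c \<sigma>"
  proof -
    have "continuous_on UNIV (\<lambda>w. ?c \<cdot> w)" by (intro continuous_intros)
    then show ?thesis
      using that \<sigma> unfolding continuous_on_iff
      by (metis (no_types, lifting) G_one(2) UNIV_I dist_0_norm dist_commute mem_ball)
  qed
  obtain \<kappa>\<^sub>2 where \<kappa>\<^sub>2: "\<kappa>\<^sub>2 > 0" "\<And>w. norm w < \<kappa>\<^sub>2 \<Longrightarrow> dist (xbar \<cdot> inv\<^bsub>G\<^esub> w) xbar < \<epsilon>\<^sub>1"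
  proof -
    have inv0: "inv\<^bsub>G\<^esub> 0 = 0" by (metis G_inv(2) G_one(1))
    have "continuous_on UNIV (\<lambda>w. xbar \<cdot> inv\<^bsub>G\<^esub> w)" by (intro continuous_intros)
    then obtain d where "d > 0" "\<And>w. dist w 0 < d \<Longrightarrow> dist (xbar \<cdot> inv\<^bsub>G\<^esub> w) (xbar \<cdot> inv\<^bsub>G\<^esub> 0) < \<epsilon>\<^sub>1"
      using \<epsilon>\<^sub>1 unfolding continuous_on_iff by blast
    then show ?thesis using that[of d] by (simp add: inv0)
  qed
  have "min \<kappa>\<^sub>1 \<kappa>\<^sub>2 > 0" using \<kappa>\<^sub>1 \<kappa>\<^sub>2 by simp
  from sr_dist_small_imp_norm_small[OF this] obtain \<eta> where \<eta>: "\<eta> > 0"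
    "\<And>r c y. r > 0 \<Longrightarrow> sr_dist X c y < ennreal (\<eta> / r) \<Longrightarrow> norm (\<delta> r (inv\<^bsub>G\<^esub> c \<cdot> y)) < min \<kappa>\<^sub>1 \<kappa>\<^sub>2"
    by blast
  \<comment> \<open>With \<open>r = p / t\<close> the radius \<open>\<epsilon> t\<close> is exactly \<open>\<eta> / r\<close>; with \<open>r = 1\<close> it suffices that \<open>\<epsilon> \<le> \<eta>\<close>.\<close>
  define \<epsilon> where "\<epsilon> = \<eta> / real p"
  have \<epsilon>: "\<epsilon> > 0" "\<epsilon> \<le> \<eta>" using \<eta>(1) \<open>p > 0\<close> by (auto simp: \<epsilon>_def divide_simps)
  have "y \<in> interior A"
    if x: "x \<in> closure A" "sr_dist X x xbar < ennreal \<epsilon>" and t: "0 < t" "t < 1"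
      and y: "sr_dist X (x \<cdot> Exp (t *\<^sub>R \<xi>)) y < ennreal (\<epsilon> * t)" for x t y
  proof -
    have "sr_dist X x xbar < ennreal (\<eta> / 1)"
      using x(2) \<epsilon>(2) by (simp add: ennreal_leI less_le_trans)
    from \<eta>(2)[OF zero_less_one this] have "dist (xbar \<cdot> inv\<^bsub>G\<^esub> (inv\<^bsub>G\<^esub> x \<cdot> xbar)) xbar < \<epsilon>\<^sub>1"
      by (intro \<kappa>\<^sub>2(2)) simp
    moreover have "xbar \<cdot> inv\<^bsub>G\<^esub> (inv\<^bsub>G\<^esub> x \<cdot> xbar) = x"
      by (metis G_assoc G_cancel(2) G_inv(2) G_one(2))
    ultimately have near: "dist x xbar < \<epsilon>\<^sub>1" by simp
    define r where "r = real p / t"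
    have r: "r > 0" "r * t = real p" using t \<open>p > 0\<close> by (auto simp: r_def)
    define w where "w = inv\<^bsub>G\<^esub> (x \<cdot> Exp (t *\<^sub>R \<xi>)) \<cdot> y"
    have "sr_dist X (x \<cdot> Exp (t *\<^sub>R \<xi>)) y < ennreal (\<eta> / r)"
      using y t by (simp add: \<epsilon>_def r_def)
    from \<eta>(2)[OF r(1) this] have "?c \<cdot> \<delta> r w \<in> ball ?c \<sigma>"
      by (intro \<kappa>\<^sub>1(2)) (simp add: w_def)
    moreover have "inv\<^bsub>G\<^esub> x \<cdot> y = Exp (t *\<^sub>R \<xi>) \<cdot> w"
      by (metis G_assoc G_cancel w_def)
    ultimately have xy: "\<delta> r (inv\<^bsub>G\<^esub> x \<cdot> y) \<in> ball ?c \<sigma>"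
      using r by (simp add: dilation_mult dilation_Exp)
    \<comment> \<open>The condition on \<open>y\<close> is open in \<open>x\<close> as well, so \<open>x\<close> may be moved from the closure into \<open>A\<close>.\<close>
    have "open ((\<lambda>x. \<delta> r (inv\<^bsub>G\<^esub> x \<cdot> y)) -` ball ?c \<sigma> \<inter> ball xbar \<epsilon>\<^sub>1)"
      by (intro open_Int open_vimage open_ball
            continuous_on_compose2[OF continuous_on_dilation[of UNIV]] continuous_intros) auto
    then obtain x' where x': "x' \<in> A" "\<delta> r (inv\<^bsub>G\<^esub> x' \<cdot> y) \<in> ball ?c \<sigma>" "dist x' xbar < \<epsilon>\<^sub>1"
      using x(1) xy near open_Int_closure_eq_empty[of "(\<lambda>x. \<delta> r (inv\<^bsub>G\<^esub> x \<cdot> y)) -` ball ?c \<sigma> \<inter> ball xbar \<epsilon>\<^sub>1" A]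
      by (auto simp: dist_commute)
    have "open ((\<lambda>y. \<delta> r (inv\<^bsub>G\<^esub> x' \<cdot> y)) -` ball ?c \<sigma>)"
      by (intro open_vimage open_ball
            continuous_on_compose2[OF continuous_on_dilation[of UNIV]] continuous_intros) auto
    moreover have "(\<lambda>y. \<delta> r (inv\<^bsub>G\<^esub> x' \<cdot> y)) -` ball ?c \<sigma> \<subseteq> A"
      using inA[OF x'(1,3) t(1)] t(2) by (auto simp: r_def)
    ultimately show ?thesis using x'(2) by (auto simp: interior_def)
  qed
  then show ?thesis
    using \<epsilon>(1) by (intro exI[of _ \<epsilon>]) (auto simp: sr_ball_def assms(3) simp flip: horizontal_scale)
qed

end
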